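(* Let $T$ be an isotropic spherical random field with harmonic coefficients $\{a_{\ell m}\}$ and angular power spectrum $\{C_\ell\}$, and let $U:\mathbb{S}^2\to\mathbb{S}^2$ be a homeomorphism. Then the deformed field $T^U(\mathbf{x})=T(U(\mathbf{x}))$ admits the spectral representation $$T^U(\mathbf{x})=\sum_{\ell'\in\mathbb{N}_0}\sum_{m'=-\ell'}^{\ell'}b_{\ell'm'}Y_{\ell'm'}(\mathbf{x}),\qquad b_{\ell'm'}=\sum_{\ell\in\mathbb{N}_0}\sum_{m=-\ell}^{\ell}Q^U_{\ell m,\ell'm'}a_{\ell m},$$ where $Q^U_{\ell m,\ell'm'}=\int_{\mathbb{S}^2}Y_{\ell m}(U(\mathbf{x}))Y^*_{\ell'm'}(\mathbf{x})\,d\mathbf{s}(\mathbf{x})$. The coefficients $\{b_{\ell m}\}$ are centered random variables with $$\mathbf{E}[b_{\ell m}b^*_{\ell'm'}]=\sum_{\tilde\ell\in\mathbb{N}_0}C_{\tilde\ell}\sum_{\tilde m=-\tilde\ell}^{\tilde\ell}Q^U_{\tilde\ell\tilde m,\ell m}\left(Q^U_{\tilde\ell\tilde m,\ell'm'}\right)^*.$$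
   Context: $T$ is a real-valued zero-mean second-order random field on the unit sphere $\mathbb{S}^2\subset\mathbb{R}^3$ with continuous, not identically constant covariance; isotropic means that the covariance depends only on the great-circle distance. $d\mathbf{s}$ is the surface measure, $*$ is complex conjugation, and $Y_{\ell m}$ are the standard complex orthonormal spherical harmonics with $Y_{\ell(-m)}=(-1)^mY^*_{\ell m}$. $T=\sum_\ell\sum_m a_{\ell m}Y_{\ell m}$ with $a_{\ell m}=\int_{\mathbb{S}^2}TY^*_{\ell m}\,d\mathbf{s}$, and $\mathbf{E}a_{\ell m}a^*_{\ell'm'}=\delta_\ell^{\ell'}\delta_m^{m'}C_\ell$. Expansions of fields in spherical harmonics are in $L^2(\Omega\times\mathbb{S}^2)$, and series of random variables converge in $L^2(\Omega)$. *)

theory Defs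
  imports "HOL-Probability.Probability" "HOL-Computational_Algebra.Polynomial"
begin

abbreviation S2 :: "(real ^ 3) set" where
  "S2 \<equiv> sphere 0 1"

definition great_circle_dist :: "real ^ 3 \<Rightarrow> real ^ 3 \<Rightarrow> real" where
  "great_circle_dist x y = arccos (x \<bullet> y)"

text \<open>Spherical coordinates: colatitude \<open>\<theta> \<in> [0, \<pi>]\<close> and longitude \<open>\<phi>\<close>.\<close>

definition sph_point :: "real \<Rightarrow> real \<Rightarrow> real ^ 3" where
  "sph_point \<theta> \<phi> = vector [sin \<theta> * cos \<phi>, sin \<theta> * sin \<phi>, cos \<theta>]"

definition colatitude :: "real ^ 3 \<Rightarrow> real" where
  "colatitude x = arccos (x $ 3)"

text \<open>Since \<open>Arg 0 = 0\<close>, the longitude of the two poles is \<open>0\<close>; the spherical harmonics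
  do not depend on that choice.\<close>

definition longitude :: "real ^ 3 \<Rightarrow> real" where
  "longitude x = Arg (Complex (x $ 1) (x $ 2))"

text \<open>The surface measure \<open>sin \<theta> d\<theta> d\<phi>\<close>, as a measure on the Borel subsets of the sphere
  (the space of the measure is the sphere, not all of \<open>\<real>\<^sup>3\<close>).\<close>

definition sphere_measure :: "(real ^ 3) measure" where
  "sphere_measure =
     distr (density (restrict_space lborel ({0..pi} \<times> {0..2 * pi})) (\<lambda>(\<theta>, \<phi>). ennreal (sin \<theta>)))
       (restrict_space borel S2) (\<lambda>(\<theta>, \<phi>). sph_point \<theta> \<phi>)"

text \<open>Legendre polynomials by Rodrigues' formula; the associated Legendre functions carry the
  Condon--Shortley phase \<open>(-1)^m\<close>.\<close>

definition legendre_poly :: "nat \<Rightarrow> real poly" where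
  "legendre_poly l = smult (1 / (2 ^ l * fact l)) ((pderiv ^^ l) ([:-1, 0, 1:] ^ l))"

definition assoc_legendre :: "nat \<Rightarrow> nat \<Rightarrow> real \<Rightarrow> real" where
  "assoc_legendre l m t = (-1) ^ m * sqrt (1 - t\<^sup>2) ^ m * poly ((pderiv ^^ m) (legendre_poly l)) t"

text \<open>The harmonics of order \<open>m \<ge> 0\<close>, extended to negative orders by
  \<open>Y l (-m) = (-1)^m * cnj (Y l m)\<close>; only \<open>\<bar>m\<bar> \<le> l\<close> is meaningful.\<close>

definition sph_harm_nonneg :: "nat \<Rightarrow> nat \<Rightarrow> real ^ 3 \<Rightarrow> complex" where
  "sph_harm_nonneg l m x =
     of_real (sqrt ((2 * real l + 1) / (4 * pi) * (fact (l - m) / fact (l + m)))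
              * assoc_legendre l m (cos (colatitude x)))
     * cis (real m * longitude x)"

definition sph_harm :: "nat \<Rightarrow> int \<Rightarrow> real ^ 3 \<Rightarrow> complex" where
  "sph_harm l m x =
     (if 0 \<le> m then sph_harm_nonneg l (nat m) x
      else (-1) ^ nat (- m) * cnj (sph_harm_nonneg l (nat (- m)) x))"

text \<open>Joint measurability on \<open>\<Omega> \<times> S\<^sup>2\<close> is what makes the field an element of
  \<open>L\<^sup>2(\<Omega> \<times> S\<^sup>2)\<close> and the harmonic coefficients random variables. The values of \<open>T \<omega>\<close> off the
  sphere play no role.\<close>

locale spherical_random_field = prob_space M
  for M :: "'w measure" and T :: "'w \<Rightarrow> real ^ 3 \<Rightarrow> real" +
  assumes jointly_measurable:
      "(\<lambda>(\<omega>, x). T \<omega> x) \<in> borel_measurable (M \<Otimes>\<^sub>M sphere_measure)"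
    and second_order: "x \<in> S2 \<Longrightarrow> integrable M (\<lambda>\<omega>. (T \<omega> x)\<^sup>2)"
    and zero_mean: "x \<in> S2 \<Longrightarrow> expectation (\<lambda>\<omega>. T \<omega> x) = 0"
    and covariance_continuous:
      "continuous_on (S2 \<times> S2) (\<lambda>(x, y). expectation (\<lambda>\<omega>. T \<omega> x * T \<omega> y))"
    and covariance_not_constant:
      "\<not> (\<exists>c. \<forall>x\<in>S2. \<forall>y\<in>S2. expectation (\<lambda>\<omega>. T \<omega> x * T \<omega> y) = c)"

locale isotropic_spherical_random_field = spherical_random_field +
  assumes isotropic:
    "\<exists>\<rho>. \<forall>x\<in>S2. \<forall>y\<in>S2. expectation (\<lambda>\<omega>. T \<omega> x * T \<omega> y) = \<rho> (great_circle_dist x y)"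

definition harmonic_coeff :: "('w \<Rightarrow> real ^ 3 \<Rightarrow> real) \<Rightarrow> nat \<Rightarrow> int \<Rightarrow> 'w \<Rightarrow> complex" where
  "harmonic_coeff T l m \<omega> = (LINT x|sphere_measure. of_real (T \<omega> x) * cnj (sph_harm l m x))"

text \<open>\<open>C\<close> is the angular power spectrum of the field with coefficients \<open>a\<close>, i.e.
  \<open>E (a l m * cnj (a l' m')) = \<delta> l l' * \<delta> m m' * C l\<close>; this determines \<open>C\<close>.\<close>

definition angular_power_spectrum ::
    "'w measure \<Rightarrow> (nat \<Rightarrow> int \<Rightarrow> 'w \<Rightarrow> complex) \<Rightarrow> (nat \<Rightarrow> real) \<Rightarrow> bool" where
  "angular_power_spectrum M a C \<longleftrightarrow>
     (\<forall>l l'. \<forall>m\<in>{- int l..int l}. \<forall>m'\<in>{- int l'..int l'}.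
        (LINT \<omega>|M. a l m \<omega> * cnj (a l' m' \<omega>)) = (if l = l' \<and> m = m' then of_real (C l) else 0))"

definition Q_coeff :: "(real ^ 3 \<Rightarrow> real ^ 3) \<Rightarrow> nat \<Rightarrow> int \<Rightarrow> nat \<Rightarrow> int \<Rightarrow> complex" where
  "Q_coeff U l m l' m' = (LINT x|sphere_measure. sph_harm l m (U x) * cnj (sph_harm l' m' x))"

definition in_L2 :: "'a measure \<Rightarrow> ('a \<Rightarrow> complex) \<Rightarrow> bool" where
  "in_L2 N f \<longleftrightarrow> f \<in> borel_measurable N \<and> integrable N (\<lambda>x. (cmod (f x))\<^sup>2)"

text \<open>Convergence of a series to \<open>s\<close> in \<open>L\<^sup>2(N)\<close>. Membership in \<open>L\<^sup>2\<close> is required explicitly,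
  as the Bochner integral of a non-integrable function is \<open>0\<close>.\<close>

definition L2_sums :: "'a measure \<Rightarrow> (nat \<Rightarrow> 'a \<Rightarrow> complex) \<Rightarrow> ('a \<Rightarrow> complex) \<Rightarrow> bool" where
  "L2_sums N f s \<longleftrightarrow>
     (\<forall>n. in_L2 N (f n)) \<and> in_L2 N s \<and>
     (\<lambda>n. LINT x|N. (cmod ((\<Sum>k<n. f k x) - s x))\<^sup>2) \<longlonglongrightarrow> 0"

end

theory Submission
  imports Defs
begin

text \<open>
  By completeness and continuity \<open>E (T x * cnj a\<^sub>l\<^sub>m) = C\<^sub>l Y\<^sub>l\<^sub>m x\<close>, so a Mercer argument gives
  \<open>T x = \<Sum> a\<^sub>l\<^sub>m Y\<^sub>l\<^sub>m x\<close> in \<open>L\<^sup>2(\<Omega>)\<close> at every single point \<open>x\<close>. Convergence almost everywhere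
  would not be enough, since preimages of null sets under \<open>U\<close> need not be null sets. The error at a point is
  at most the variance, which is bounded, so substituting \<open>U x\<close> and integrating against a harmonic identifies
  the \<open>b\<close>'s with the harmonic coefficients of \<open>T \<circ> U\<close>. The residual energy of \<open>T \<circ> U\<close> is the sum over
  \<open>k\<close> of \<open>C\<^sub>k\<close> times the residual energies of the functions \<open>Y\<^sub>k\<^sub>n \<circ> U\<close>; each of these vanishes in
  the limit by Parseval's identity for continuous functions, and Tannery's theorem sums the limits.
\<close>

section \<open>Square-integrable functions\<close>

text \<open>Sample paths are known to be square-integrable on the sphere only almost surely, whereas
  Parseval's identity is proved for continuous functions. It is therefore never applied to a path:
  the energy of the deformed field is distributed, with weights \<open>C k\<close>, over the
  functions \<open>sph_harm k n (U x)\<close>, which are continuous. Also, the series fix the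
  coefficients \<open>b\<close> only up to null sets, so one version, the harmonic coefficients of
  the deformed field, is singled out and every other family is compared with it.

  In the Mercer argument the nonnegativity of \<open>C\<close> is decisive: Cauchy-Schwarz splits a
  tail of the kernel into a factor in \<open>y\<close>, bounded by the variance, and a factor in
  \<open>x\<close>, the tail of a bounded monotone sum. For fixed \<open>x\<close> the convergence
  is thus uniform in \<open>y\<close>, and the limit is continuous.

  Completeness rests on the Stone-Weierstrass theorem: on the sphere the harmonics are polynomials
  in the coordinates, and every polynomial is a combination of them there.\<close>

abbreviation (input) L2_norm_sq :: "'a measure \<Rightarrow> ('a \<Rightarrow> complex) \<Rightarrow> real" where
  "L2_norm_sq N f \<equiv> (LINT x|N. (cmod (f x))\<^sup>2)"

abbreviation (input) L2_inner :: "'a measure \<Rightarrow> ('a \<Rightarrow> complex) \<Rightarrow> ('a \<Rightarrow> complex) \<Rightarrow> complex" where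
  "L2_inner N f g \<equiv> (LINT x|N. f x * cnj (g x))"

lemma borel_measurable_cnj [measurable (raw)]:
  "f \<in> borel_measurable N \<Longrightarrow> (\<lambda>x. cnj (f x)) \<in> borel_measurable N"
  by (rule measurable_compose[of f N borel]) (auto intro!: borel_measurable_continuous_onI continuous_intros)

lemma in_L2_measurable: "in_L2 N f \<Longrightarrow> f \<in> borel_measurable N"
  and in_L2_integrable_sq: "in_L2 N f \<Longrightarrow> integrable N (\<lambda>x. (cmod (f x))\<^sup>2)"
  by (auto simp: in_L2_def)

lemma in_L2_zero [simp]: "in_L2 N (\<lambda>x. 0)"
  by (simp add: in_L2_def)

lemma in_L2_mult_const: "in_L2 N f \<Longrightarrow> in_L2 N (\<lambda>x. c * f x)"
  by (auto simp: in_L2_def norm_mult power_mult_distrib)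

lemma cmod_add_sq_le: "(cmod (z + w))\<^sup>2 \<le> 2 * (cmod z)\<^sup>2 + 2 * (cmod w)\<^sup>2"
proof -
  have "(cmod (z + w))\<^sup>2 \<le> (cmod z + cmod w)\<^sup>2"
    by (intro power_mono norm_triangle_ineq) simp
  also have "\<dots> \<le> 2 * (cmod z)\<^sup>2 + 2 * (cmod w)\<^sup>2"
    using sum_squares_bound[of "cmod z" "cmod w"] by (simp add: power2_sum)
  finally show ?thesis .
qed

lemma in_L2_add:
  assumes "in_L2 N f" "in_L2 N g"
  shows "in_L2 N (\<lambda>x. f x + g x)"
  unfolding in_L2_def
proof
  have [measurable]: "f \<in> borel_measurable N" "g \<in> borel_measurable N"
    using assms by (auto simp: in_L2_def)
  show "(\<lambda>x. f x + g x) \<in> borel_measurable N" by simp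
  have "integrable N (\<lambda>x. 2 * (cmod (f x))\<^sup>2 + 2 * (cmod (g x))\<^sup>2)"
    using assms by (auto simp: in_L2_def)
  then show "integrable N (\<lambda>x. (cmod (f x + g x))\<^sup>2)"
    by (rule Bochner_Integration.integrable_bound) (auto simp: cmod_add_sq_le)
qed

lemma in_L2_uminus: "in_L2 N f \<Longrightarrow> in_L2 N (\<lambda>x. - f x)"
  using in_L2_mult_const[of N f "-1"] by simp

lemma in_L2_diff: "in_L2 N f \<Longrightarrow> in_L2 N g \<Longrightarrow> in_L2 N (\<lambda>x. f x - g x)"
  using in_L2_add[of N f "\<lambda>x. - g x"] in_L2_uminus[of N g] by simp

lemma in_L2_cnj: "in_L2 N f \<Longrightarrow> in_L2 N (\<lambda>x. cnj (f x))"
  by (auto simp: in_L2_def)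

lemma in_L2_sum: "(\<And>i. i \<in> I \<Longrightarrow> in_L2 N (f i)) \<Longrightarrow> in_L2 N (\<lambda>x. \<Sum>i\<in>I. f i x)"
  by (induction I rule: infinite_finite_induct) (auto intro: in_L2_add)

lemma in_L2_bounded:
  assumes "finite_measure N" "f \<in> borel_measurable N" "\<And>x. x \<in> space N \<Longrightarrow> cmod (f x) \<le> B"
  shows "in_L2 N f"
proof -
  interpret finite_measure N by fact
  have "integrable N (\<lambda>x. (cmod (f x))\<^sup>2)"
    using assms(2,3) by (intro integrable_const_bound[where B = "B\<^sup>2"] AE_I2) (auto intro!: power_mono)
  with assms(2) show ?thesis by (simp add: in_L2_def)
qed

section \<open>Inner products of square-integrable functions\<close>

lemma integrable_cmod_mult:
  assumes "in_L2 N f" "in_L2 N g"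
  shows "integrable N (\<lambda>x. cmod (f x) * cmod (g x))"
proof -
  have [measurable]: "f \<in> borel_measurable N" "g \<in> borel_measurable N"
    using assms by (auto simp: in_L2_def)
  have "integrable N (\<lambda>x. (cmod (f x))\<^sup>2 + (cmod (g x))\<^sup>2)"
    using assms by (auto simp: in_L2_def)
  then show ?thesis
  proof (rule Bochner_Integration.integrable_bound)
    have "norm (cmod (f x) * cmod (g x)) \<le> norm ((cmod (f x))\<^sup>2 + (cmod (g x))\<^sup>2)" for x
    proof -
      have "cmod (f x) * cmod (g x) \<ge> 0" by simp
      then have "cmod (f x) * cmod (g x) \<le> (cmod (f x))\<^sup>2 + (cmod (g x))\<^sup>2"
        using sum_squares_bound[of "cmod (f x)" "cmod (g x)"] by linarith
      then show ?thesis by simp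
    qed
    then show "AE x in N. norm (cmod (f x) * cmod (g x)) \<le> norm ((cmod (f x))\<^sup>2 + (cmod (g x))\<^sup>2)" by simp
  qed simp
qed

lemma integrable_L2_inner:
  assumes "in_L2 N f" "in_L2 N g"
  shows "integrable N (\<lambda>x. f x * cnj (g x))"
proof -
  have [measurable]: "f \<in> borel_measurable N" "g \<in> borel_measurable N"
    using assms by (auto simp: in_L2_def)
  show ?thesis
    by (rule Bochner_Integration.integrable_bound[OF integrable_cmod_mult[OF assms]])
      (auto simp: norm_mult)
qed

lemma integrable_L2_mult:
  assumes "in_L2 N f" "in_L2 N g"
  shows "integrable N (\<lambda>x. f x * g x)"
  using integrable_L2_inner[OF assms(1) in_L2_cnj[OF assms(2)]] by simp

lemma in_L2_integrable:
  assumes "finite_measure N" "in_L2 N f"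
  shows "integrable N f"
  using integrable_L2_mult[OF assms(2), of "\<lambda>x. 1"] in_L2_bounded[OF assms(1), of "\<lambda>x. 1" 1] by simp

lemma L2_inner_self: "L2_inner N f f = of_real (L2_norm_sq N f)"
proof -
  have "(\<lambda>x. f x * cnj (f x)) = (\<lambda>x. of_real ((cmod (f x))\<^sup>2))"
    by (simp only: complex_norm_square)
  then show ?thesis by (simp only: integral_complex_of_real)
qed

lemma L2_inner_commute: "L2_inner N g f = cnj (L2_inner N f g)"
  by (simp only: Bochner_Integration.integral_cnj[symmetric] complex_cnj_mult complex_cnj_cnj mult.commute)

lemma L2_norm_sq_nonneg: "0 \<le> L2_norm_sq N f"
  by simp

text \<open>Reduces to the inequality for nonnegative integrals of the moduli. Square-integrability
  makes all the extended nonnegative integrals finite, so the inequality descends to the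
  reals.\<close>

lemma L2_Cauchy_Schwarz:
  assumes "in_L2 N f" "in_L2 N g"
  shows "(cmod (L2_inner N f g))\<^sup>2 \<le> L2_norm_sq N f * L2_norm_sq N g"
proof -
  have [measurable]: "f \<in> borel_measurable N" "g \<in> borel_measurable N"
    using assms by (auto simp: in_L2_def)
  let ?D = "LINT x|N. cmod (f x) * cmod (g x)"
  have nn: "(\<integral>\<^sup>+x. ennreal (cmod (f x)) * ennreal (cmod (g x)) \<partial>N) = ennreal ?D"
    using nn_integral_eq_integral[OF integrable_cmod_mult[OF assms]] by (simp add: ennreal_mult)
  have sq: "(\<integral>\<^sup>+x. (ennreal (cmod (h x)))\<^sup>2 \<partial>N) = ennreal (L2_norm_sq N h)" if "in_L2 N h" for h
    using nn_integral_eq_integral[OF in_L2_integrable_sq[OF that]] by (simp add: ennreal_power)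
  have "ennreal (?D\<^sup>2) \<le> ennreal (L2_norm_sq N f * L2_norm_sq N g)"
    using Cauchy_Schwarz_nn_integral[of "\<lambda>x. ennreal (cmod (f x))" N "\<lambda>x. ennreal (cmod (g x))"]
    by (simp only: nn sq assms) (simp add: ennreal_power ennreal_mult del: ennreal_le_iff)
  then have D: "?D\<^sup>2 \<le> L2_norm_sq N f * L2_norm_sq N g"
    by (subst (asm) ennreal_le_iff) auto
  have "cmod (L2_inner N f g) \<le> (LINT x|N. cmod (f x * cnj (g x)))"
    by (rule integral_norm_bound)
  also have "\<dots> = ?D" by (simp add: norm_mult)
  finally have "(cmod (L2_inner N f g))\<^sup>2 \<le> ?D\<^sup>2" by (intro power_mono) auto
  with D show ?thesis by (rule order_trans[rotated])
qed

lemma L2_norm_sq_diff: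
  assumes "in_L2 N f" "in_L2 N g"
  shows "L2_norm_sq N (\<lambda>x. f x - g x) = L2_norm_sq N f - 2 * Re (L2_inner N f g) + L2_norm_sq N g"
proof -
  have e: "(cmod (f x - g x))\<^sup>2 = (cmod (f x))\<^sup>2 - 2 * Re (f x * cnj (g x)) + (cmod (g x))\<^sup>2" for x
    unfolding cmod_power2 by (simp add: power2_eq_square algebra_simps)
  have "integrable N (\<lambda>x. Re (f x * cnj (g x)))" 
    using integrable_L2_inner[OF assms] by (rule integrable_Re)
  moreover have "(LINT x|N. Re (f x * cnj (g x))) = Re (L2_inner N f g)"
    using integrable_L2_inner[OF assms] by (rule integral_Re)
  ultimately show ?thesis
    unfolding e using assms by (simp add: in_L2_def del: times_complex.sel)
qed

lemma L2_norm_sq_add_le: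
  assumes "in_L2 N f" "in_L2 N g"
  shows "L2_norm_sq N (\<lambda>x. f x + g x) \<le> 2 * L2_norm_sq N f + 2 * L2_norm_sq N g"
proof -
  have "L2_norm_sq N (\<lambda>x. f x + g x) \<le> (LINT x|N. 2 * (cmod (f x))\<^sup>2 + 2 * (cmod (g x))\<^sup>2)"
    using assms in_L2_add[OF assms]
    by (intro integral_mono) (auto simp: in_L2_def cmod_add_sq_le)
  also have "\<dots> = 2 * L2_norm_sq N f + 2 * L2_norm_sq N g"
    using assms by (simp add: in_L2_def)
  finally show ?thesis .
qed

lemma L2_inner_diff_left:
  assumes "in_L2 N f" "in_L2 N g" "in_L2 N h"
  shows "L2_inner N (\<lambda>x. f x - g x) h = L2_inner N f h - L2_inner N g h"
  using assms by (simp add: left_diff_distrib integrable_L2_inner)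

lemma L2_inner_diff_right:
  assumes "in_L2 N f" "in_L2 N g" "in_L2 N h"
  shows "L2_inner N h (\<lambda>x. f x - g x) = L2_inner N h f - L2_inner N h g"
  using assms by (simp add: right_diff_distrib integrable_L2_inner)

lemma L2_inner_sum_left:
  assumes "\<And>i. i \<in> I \<Longrightarrow> in_L2 N (f i)" "in_L2 N g"
  shows "L2_inner N (\<lambda>x. \<Sum>i\<in>I. c i * f i x) g = (\<Sum>i\<in>I. c i * L2_inner N (f i) g)"
  using assms by (simp add: sum_distrib_right integrable_L2_inner mult.assoc)

lemma L2_inner_sum_right:
  assumes "\<And>i. i \<in> I \<Longrightarrow> in_L2 N (f i)" "in_L2 N g"
  shows "L2_inner N g (\<lambda>x. \<Sum>i\<in>I. c i * f i x) = (\<Sum>i\<in>I. cnj (c i) * L2_inner N g (f i))"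
proof -
  have "L2_inner N g (\<lambda>x. \<Sum>i\<in>I. c i * f i x) = (LINT x|N. (\<Sum>i\<in>I. cnj (c i) * (g x * cnj (f i x))))"
    by (simp add: sum_distrib_left mult_ac)
  also have "\<dots> = (\<Sum>i\<in>I. cnj (c i) * L2_inner N g (f i))"
    using assms by (simp add: integrable_L2_inner)
  finally show ?thesis .
qed

text \<open>With \<open>d = f n - f'\<close> and \<open>e = g n - g'\<close>, the difference of the
  inner products is that of \<open>d\<close> with \<open>e\<close>, plus that of \<open>d\<close>
  with \<open>g'\<close>, plus that of \<open>f'\<close> with \<open>e\<close>. Cauchy-Schwarz makes
  each of the three small.\<close>

lemma L2_inner_tendsto:
  assumes f: "\<And>n. in_L2 N (f n)" "in_L2 N f'" "(\<lambda>n. L2_norm_sq N (\<lambda>x. f n x - f' x)) \<longlonglongrightarrow> 0"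
    and g: "\<And>n. in_L2 N (g n)" "in_L2 N g'" "(\<lambda>n. L2_norm_sq N (\<lambda>x. g n x - g' x)) \<longlonglongrightarrow> 0"
  shows "(\<lambda>n. L2_inner N (f n) (g n)) \<longlonglongrightarrow> L2_inner N f' g'"
proof -
  let ?F = "\<lambda>n. L2_norm_sq N (\<lambda>x. f n x - f' x)"
  let ?G = "\<lambda>n. L2_norm_sq N (\<lambda>x. g n x - g' x)"
  have bnd: "cmod (L2_inner N h k) \<le> sqrt (L2_norm_sq N h * L2_norm_sq N k)"
    if "in_L2 N h" "in_L2 N k" for h k
    using L2_Cauchy_Schwarz[OF that] by (simp add: real_le_rsqrt)
  have split: "L2_inner N (f n) (g n) - L2_inner N f' g' =
     L2_inner N (\<lambda>x. f n x - f' x) (\<lambda>x. g n x - g' x)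
     + L2_inner N (\<lambda>x. f n x - f' x) g' + L2_inner N f' (\<lambda>x. g n x - g' x)" for n
    using f(1)[of n] f(2) g(1)[of n] g(2)
    by (simp add: L2_inner_diff_left L2_inner_diff_right in_L2_diff del: complex_cnj_diff)
  have "(\<lambda>n. L2_inner N (f n) (g n) - L2_inner N f' g') \<longlonglongrightarrow> 0"
  proof (rule Lim_null_comparison)
    show "\<forall>\<^sub>F n in sequentially. cmod (L2_inner N (f n) (g n) - L2_inner N f' g') \<le>
        sqrt (?F n * ?G n) + sqrt (?F n * L2_norm_sq N g') + sqrt (L2_norm_sq N f' * ?G n)"
      unfolding split
      using f(1,2) g(1,2)
      by (intro always_eventually allI order_trans[OF norm_triangle_ineq] add_mono bnd in_L2_diff) auto
    have "(\<lambda>n. sqrt (?F n * ?G n) + sqrt (?F n * L2_norm_sq N g') + sqrt (L2_norm_sq N f' * ?G n))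
      \<longlonglongrightarrow> sqrt (0 * 0) + sqrt (0 * L2_norm_sq N g') + sqrt (L2_norm_sq N f' * 0)"
      by (intro tendsto_intros f(3) g(3))
    then show "(\<lambda>n. sqrt (?F n * ?G n) + sqrt (?F n * L2_norm_sq N g') + sqrt (L2_norm_sq N f' * ?G n))
      \<longlonglongrightarrow> 0" by simp
  qed
  then show ?thesis by (simp add: LIM_zero_iff)
qed

lemma L2_norm_sq_eq_0:
  assumes "in_L2 N f" "L2_norm_sq N f = 0"
  shows "AE x in N. f x = 0"
  using assms integral_nonneg_eq_0_iff_AE[OF in_L2_integrable_sq[OF assms(1)]] by simp

lemma L2_limit_unique:
  assumes "\<And>n. in_L2 N (f n)" "in_L2 N s" "in_L2 N t"
    and "(\<lambda>n. L2_norm_sq N (\<lambda>x. f n x - s x)) \<longlonglongrightarrow> 0" "(\<lambda>n. L2_norm_sq N (\<lambda>x. f n x - t x)) \<longlonglongrightarrow> 0"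
  shows "AE x in N. s x = t x"
proof -
  have le: "L2_norm_sq N (\<lambda>x. s x - t x)
      \<le> 2 * L2_norm_sq N (\<lambda>x. f n x - s x) + 2 * L2_norm_sq N (\<lambda>x. f n x - t x)" for n
    using L2_norm_sq_add_le[of N "\<lambda>x. s x - f n x" "\<lambda>x. f n x - t x"] assms(1-3)
    by (simp add: in_L2_diff norm_minus_commute)
  have "(\<lambda>n. 2 * L2_norm_sq N (\<lambda>x. f n x - s x) + 2 * L2_norm_sq N (\<lambda>x. f n x - t x))
      \<longlonglongrightarrow> 2 * 0 + 2 * 0"
    by (intro tendsto_intros assms)
  then have "L2_norm_sq N (\<lambda>x. s x - t x) \<le> 2 * 0 + 2 * 0"
    by (rule LIMSEQ_le_const) (use le in blast)
  then have "L2_norm_sq N (\<lambda>x. s x - t x) = 0"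
    by (simp add: order_antisym)
  then have "AE x in N. s x - t x = 0"
    using assms(2,3) by (intro L2_norm_sq_eq_0 in_L2_diff)
  then show ?thesis by simp
qed

text \<open>The squared norms \<open>\<gamma> i\<close> are kept as weights instead of being
  normalised to 1, because the family meant here includes the random coefficients of the field,
  whose variances \<open>C l\<close> may vanish.\<close>

lemma L2_norm_sq_diff_orthogonal:
  assumes f: "in_L2 N f" and e: "\<And>i. i \<in> I \<Longrightarrow> in_L2 N (e i)" and "finite I"
    and orth: "\<And>i j. i \<in> I \<Longrightarrow> j \<in> I \<Longrightarrow> L2_inner N (e i) (e j) = (if i = j then of_real (\<gamma> i) else 0)"
  shows "L2_norm_sq N (\<lambda>x. f x - (\<Sum>i\<in>I. c i * e i x))
    = L2_norm_sq N f - 2 * (\<Sum>i\<in>I. Re (cnj (c i) * L2_inner N f (e i))) + (\<Sum>i\<in>I. (cmod (c i))\<^sup>2 * \<gamma> i)"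
proof -
  let ?s = "\<lambda>x. \<Sum>i\<in>I. c i * e i x"
  have s: "in_L2 N ?s" by (intro in_L2_sum in_L2_mult_const e)
  have "L2_inner N ?s ?s = (\<Sum>j\<in>I. cnj (c j) * L2_inner N ?s (e j))"
    by (rule L2_inner_sum_right[OF e s])
  also have "\<dots> = (\<Sum>j\<in>I. cnj (c j) * (\<Sum>i\<in>I. c i * L2_inner N (e i) (e j)))"
    using e by (intro sum.cong refl arg_cong2[where f = "(*)"] L2_inner_sum_left)
  also have "\<dots> = (\<Sum>j\<in>I. cnj (c j) * (c j * of_real (\<gamma> j)))"
  proof (intro sum.cong refl arg_cong2[where f = "(*)"])
    fix j assume j: "j \<in> I"
    have "(\<Sum>i\<in>I. c i * L2_inner N (e i) (e j)) = (\<Sum>i\<in>I. if i = j then c j * of_real (\<gamma> j) else 0)"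
      using j by (intro sum.cong refl) (simp add: orth)
    then show "(\<Sum>i\<in>I. c i * L2_inner N (e i) (e j)) = c j * of_real (\<gamma> j)"
      using j \<open>finite I\<close> by simp
  qed
  also have "\<dots> = of_real (\<Sum>i\<in>I. (cmod (c i))\<^sup>2 * \<gamma> i)"
    unfolding of_real_sum of_real_mult complex_norm_square by (simp add: mult_ac)
  finally have "complex_of_real (L2_norm_sq N ?s) = of_real (\<Sum>i\<in>I. (cmod (c i))\<^sup>2 * \<gamma> i)"
    by (simp only: L2_inner_self)
  then have ss: "L2_norm_sq N ?s = (\<Sum>i\<in>I. (cmod (c i))\<^sup>2 * \<gamma> i)"
    by (simp only: of_real_eq_iff)
  have fs: "L2_inner N f ?s = (\<Sum>i\<in>I. cnj (c i) * L2_inner N f (e i))"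
    by (rule L2_inner_sum_right[OF e f])
  show ?thesis
    unfolding L2_norm_sq_diff[OF f s] ss fs Re_sum ..
qed

text \<open>Completes the square in the coefficients \<open>c\<close>. Choosing \<open>c\<close> as
  the Fourier coefficients kills the last sum and yields Bessel's inequality; dropping that
  nonnegative sum shows that no other choice approximates better.\<close>

lemma L2_norm_sq_diff_orthonormal:
  assumes f: "in_L2 N f" and e: "\<And>i. i \<in> I \<Longrightarrow> in_L2 N (e i)" and "finite I"
    and orth: "\<And>i j. i \<in> I \<Longrightarrow> j \<in> I \<Longrightarrow> L2_inner N (e i) (e j) = (if i = j then 1 else 0)"
  shows "L2_norm_sq N (\<lambda>x. f x - (\<Sum>i\<in>I. c i * e i x))
    = L2_norm_sq N f - (\<Sum>i\<in>I. (cmod (L2_inner N f (e i)))\<^sup>2) + (\<Sum>i\<in>I. (cmod (c i - L2_inner N f (e i)))\<^sup>2)"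
proof -
  have o: "L2_inner N (e i) (e j) = (if i = j then of_real 1 else 0)" if "i \<in> I" "j \<in> I" for i j
    using orth[OF that] by simp
  have q: "(cmod (z - w))\<^sup>2 = (cmod z)\<^sup>2 - 2 * Re (cnj z * w) + (cmod w)\<^sup>2" for z w
    unfolding cmod_power2 by (simp add: power2_eq_square algebra_simps)
  have "(\<Sum>i\<in>I. (cmod (c i - L2_inner N f (e i)))\<^sup>2) = (\<Sum>i\<in>I. (cmod (c i))\<^sup>2)
      - 2 * (\<Sum>i\<in>I. Re (cnj (c i) * L2_inner N f (e i))) + (\<Sum>i\<in>I. (cmod (L2_inner N f (e i)))\<^sup>2)"
    by (simp only: q sum.distrib sum_subtractf sum_distrib_left)
  moreover have "L2_norm_sq N (\<lambda>x. f x - (\<Sum>i\<in>I. c i * e i x))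
    = L2_norm_sq N f - 2 * (\<Sum>i\<in>I. Re (cnj (c i) * L2_inner N f (e i))) + (\<Sum>i\<in>I. (cmod (c i))\<^sup>2 * 1)"
    by (rule L2_norm_sq_diff_orthogonal[OF f e \<open>finite I\<close> o])
  ultimately show ?thesis by simp
qed

section \<open>Legendre polynomials\<close>

text \<open>This is the integral of \<open>p\<close> over [-1, 1], kept in the angle because the
  surface measure produces exactly the factor \<open>sin \<theta>\<close>.\<close>

definition polar_integral :: "real poly \<Rightarrow> real" where
  "polar_integral p = integral {0..pi} (\<lambda>\<theta>. sin \<theta> * poly p (cos \<theta>))"

lemma polar_integrable: "(\<lambda>\<theta>. sin \<theta> * poly p (cos \<theta>)) integrable_on {0..pi}"
  by (intro integrable_continuous_real continuous_intros)

lemma polar_integral_add: "polar_integral (p + q) = polar_integral p + polar_integral q"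
  unfolding polar_integral_def
  by (simp add: distrib_left integral_add polar_integrable)

lemma polar_integral_smult: "polar_integral (smult c p) = c * polar_integral p"
  unfolding polar_integral_def
  by (simp add: mult.left_commute)

lemma polar_integral_uminus: "polar_integral (- p) = - polar_integral p"
  using polar_integral_smult[of "-1" p] by simp

lemma polar_integral_diff: "polar_integral (p - q) = polar_integral p - polar_integral q"
  using polar_integral_add[of p "- q"] by (simp add: polar_integral_uminus)

text \<open>The substitution \<open>t = cos \<theta>\<close> turns this into the fundamental theorem on \<open>[-1, 1]\<close>.\<close>

lemma polar_integral_pderiv: "polar_integral (pderiv p) = poly p 1 - poly p (-1)"
proof -
  have "((\<lambda>\<theta>. sin \<theta> * poly (pderiv p) (cos \<theta>)) has_integral
      (- poly p (cos pi)) - (- poly p (cos 0))) {0..pi}"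
  proof (rule fundamental_theorem_of_calculus)
    fix \<theta> :: real assume "\<theta> \<in> {0..pi}"
    have "((\<lambda>\<theta>. - poly p (cos \<theta>)) has_field_derivative - (poly (pderiv p) (cos \<theta>) * (- sin \<theta>))) (at \<theta>)"
      by (intro DERIV_minus DERIV_chain2[OF poly_DERIV] DERIV_cos)
    then show "((\<lambda>\<theta>. - poly p (cos \<theta>)) has_vector_derivative sin \<theta> * poly (pderiv p) (cos \<theta>))
        (at \<theta> within {0..pi})"
      by (simp add: has_real_derivative_iff_has_vector_derivative mult.commute has_vector_derivative_at_within)
  qed simp
  then show ?thesis unfolding polar_integral_def by (simp add: integral_unique)
qed

section \<open>Rodrigues' formula and the differentiated Legendre equation\<close>

abbreviation one_minus_sq :: "real poly" where
  "one_minus_sq \<equiv> [:1, 0, -1:]"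

abbreviation rodrigues :: "nat \<Rightarrow> nat \<Rightarrow> real poly" where
  "rodrigues l k \<equiv> (pderiv ^^ k) ([:-1, 0, 1:] ^ l)"

text \<open>The power w = (t^2 - 1)^l satisfies (t^2 - 1) w' = 2 l t w. Differentiating this
  \<open>k + 1\<close> times by Leibniz' rule gives the claim; the induction performs one
  differentiation per step, the base case the first of them.\<close>

lemma rodrigues_ode:
  "[:-1, 0, 1:] * rodrigues l (k + 2) + smult (2 * (real k + 1) - 2 * real l) ([:0, 1:] * rodrigues l (k + 1))
    + smult (real k * (real k + 1) - 2 * real l * (real k + 1)) (rodrigues l k) = 0"
proof (induction k)
  case 0
  have first: "[:-1, 0, 1:] * rodrigues l 1 = smult (2 * real l) ([:0, 1:] * rodrigues l 0)"
  proof (cases l)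
    case (Suc n)
    have "[:-1, 0, 1:] * rodrigues l 1
        = smult (real l) (([:-1, 0, 1:] * [:-1, 0, 1:] ^ n) * pderiv [:-1, 0, 1:])"
      by (simp only: funpow_0 One_nat_def funpow.simps o_apply id_apply pderiv_power Suc diff_Suc_Suc diff_zero mult_smult_right mult.assoc)
    also have "pderiv [:-1, 0, 1:: real:] = smult 2 [:0, 1:]"
      by (simp add: pderiv_pCons)
    also have "[:-1, 0, 1:] * [:-1, 0, 1:] ^ n = rodrigues l 0"
      by (simp only: Suc funpow_0 power_Suc)
    finally have "[:-1, 0, 1:] * rodrigues l 1 = smult (real l) (rodrigues l 0 * smult 2 [:0, 1:])" .
    then show ?thesis
      by (metis mult_smult_right smult_smult mult.commute)
  qed simp
  have X: "pderiv [:-1, 0, 1:: real:] = smult 2 [:0, 1:]" "pderiv [:0, 1::real:] = 1"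
    by (simp_all add: pderiv_pCons one_pCons)
  have "pderiv ([:-1, 0, 1:] * rodrigues l 1) = pderiv (smult (2 * real l) ([:0, 1:] * rodrigues l 0))"
    by (simp only: first)
  then have "[:-1, 0, 1:] * rodrigues l 2 + rodrigues l 1 * smult 2 [:0, 1:]
     = smult (2 * real l) ([:0, 1:] * rodrigues l 1 + rodrigues l 0)"
    by (simp only: pderiv_mult pderiv_smult X) (simp add: numeral_2_eq_2)
  then have "\<And>x. poly ([:-1, 0, 1:] * rodrigues l 2 + rodrigues l 1 * smult 2 [:0, 1:]) x
     = poly (smult (2 * real l) ([:0, 1:] * rodrigues l 1 + rodrigues l 0)) x" by metis
  then show ?case
    by (intro poly_ext) (simp add: algebra_simps numeral_2_eq_2)
next
  case (Suc k)
  have X: "pderiv [:-1, 0, 1:: real:] = smult 2 [:0, 1:]" "pderiv [:0, 1::real:] = 1"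
    by (simp_all add: pderiv_pCons one_pCons)
  have d: "pderiv (rodrigues l j) = rodrigues l (j + 1)" for j by simp
  have "pderiv ([:-1, 0, 1:] * rodrigues l (k + 2) + smult (2
      * (real k + 1) - 2 * real l) ([:0, 1:] * rodrigues l (k + 1))
    + smult (real k * (real k + 1) - 2 * real l * (real k + 1)) (rodrigues l k)) = 0"
    by (simp only: Suc pderiv_0)
  then have "[:-1, 0, 1:] * rodrigues l (k + 2 + 1) + rodrigues l (k + 2) * smult 2 [:0, 1:]
    + smult (2 * (real k + 1) - 2 * real l) ([:0, 1:] * rodrigues l (k + 1 + 1) + rodrigues l (k + 1) * 1)
    + smult (real k * (real k + 1) - 2 * real l * (real k + 1)) (rodrigues l (k + 1)) = 0"
    by (simp only: pderiv_add pderiv_mult pderiv_smult X d)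
  then have e: "poly ([:-1, 0, 1:] * rodrigues l (k + 2 + 1) + rodrigues l (k + 2) * smult 2 [:0, 1:]
    + smult (2 * (real k + 1) - 2 * real l) ([:0, 1:] * rodrigues l (k + 1 + 1) + rodrigues l (k + 1) * 1)
    + smult (real k * (real k + 1) - 2 * real l * (real k + 1)) (rodrigues l (k + 1))) x = 0" for x
    by (metis poly_0)
  have i: "Suc k + 2 = k + 2 + 1" "Suc k + 1 = k + 2" "k + 1 + 1 = k + 2" "Suc k = k + 1" by simp_all
  have n: "real (k + 1) = real k + 1" by simp
  show ?case
  proof (rule poly_ext)
    fix x
    show "poly ([:-1, 0, 1:] * rodrigues l (Suc k + 2)
      + smult (2 * (real (Suc k) + 1) - 2 * real l) ([:0, 1:] * rodrigues l (Suc k + 1))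
      + smult (real (Suc k) * (real (Suc k) + 1) - 2 * real l * (real (Suc k) + 1)) (rodrigues l (Suc k))) x
          = poly 0 x"
      using e[of x] unfolding i n
      by (simp only: poly_add poly_mult poly_smult poly_pCons poly_0 poly_1) (simp add: algebra_simps)
  qed
qed

lemma pderiv_legendre_poly:
  "(pderiv ^^ m) (legendre_poly l) = smult (1 / (2 ^ l * fact l)) (rodrigues l (l + m))"
  by (simp only: legendre_poly_def higher_pderiv_smult funpow_add o_apply add.commute[of l])

text \<open>The case \<open>k = l + m\<close> of \<open>rodrigues_ode\<close> in self-adjoint form:
  the weight (1 - t^2)^(m+1) absorbs the first-order term. The eigenvalue arises from (l+m)(l+m+1) -
  2l(l+m+1) = -(l-m)(l+m+1).\<close>

lemma legendre_sturm_liouville: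
  "pderiv (one_minus_sq ^ Suc m * (pderiv ^^ Suc m) (legendre_poly l))
    = smult (- ((real l - real m) * (real l + real m + 1))) (one_minus_sq ^ m
        * (pderiv ^^ m) (legendre_poly l))"
proof (rule poly_ext)
  fix x :: real
  let ?c = "1 / (2 ^ l * fact l) :: real"
  define u where "u j = poly (rodrigues l (l + j)) x" for j
  have Q: "pderiv one_minus_sq = [:0, -2:]"
    by (simp add: pderiv_pCons)
  have d: "pderiv ((pderiv ^^ Suc m) (legendre_poly l)) = smult ?c (rodrigues l (l + m + 2))"
    using pderiv_legendre_poly[of "Suc (Suc m)" l] by (simp add: numeral_2_eq_2)
  have "poly (pderiv (one_minus_sq ^ Suc m * (pderiv ^^ Suc m) (legendre_poly l))) x
     = (1 - x\<^sup>2) ^ m * ?c * ((1 - x\<^sup>2) * u (m + 2) - 2 * (real m + 1) * x * u (m + 1))"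
    unfolding pderiv_mult d unfolding pderiv_legendre_poly pderiv_power_Suc Q u_def
    by (simp add: algebra_simps power2_eq_square add_divide_distrib del: funpow.simps)
  also have "(1 - x\<^sup>2) * u (m + 2) - 2 * (real m + 1) * x * u (m + 1)
     = - ((real l - real m) * (real l + real m + 1)) * u m"
  proof -
    have "poly ([:-1, 0, 1:] * rodrigues l (l + m + 2)
        + smult (2 * (real (l + m) + 1) - 2 * real l) ([:0, 1:] * rodrigues l (l + m + 1))
        + smult (real (l + m) * (real (l + m) + 1) - 2 * real l * (real (l + m) + 1)) (rodrigues l (l + m))) x
            = 0"
      by (simp only: rodrigues_ode poly_0)
    then have "(x\<^sup>2 - 1) * u (m + 2) + (2 * (real l + real m + 1) - 2 * real l) * (x * u (m + 1))
        + ((real l + real m) * (real l + real m + 1) - 2 * real l * (real l + real m + 1)) * u m = 0"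
      unfolding u_def
      by (simp only: poly_add poly_mult poly_smult poly_pCons poly_0 of_nat_add)
        (simp add: power2_eq_square add.assoc)
    then show ?thesis by (simp add: algebra_simps)
  qed
  also have "(1 - x\<^sup>2) ^ m * ?c * (- ((real l - real m) * (real l + real m + 1)) * u m)
     = poly (smult (- ((real l - real m) * (real l + real m + 1))) (one_minus_sq ^ m
         * (pderiv ^^ m) (legendre_poly l))) x"
    unfolding pderiv_legendre_poly u_def
    by (simp add: power2_eq_square algebra_simps add_divide_distrib del: funpow.simps)
  finally show "poly (pderiv (one_minus_sq ^ Suc m * (pderiv ^^ Suc m) (legendre_poly l))) x
     = poly (smult (- ((real l - real m) * (real l + real m + 1))) (one_minus_sq ^ m
         * (pderiv ^^ m) (legendre_poly l))) x" .
qed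

text \<open>For Legendre polynomials this is the inner product of two associated Legendre functions
  of order \<open>m\<close>: their factors (1 - t^2)^(m/2) are merged into one integral power, so
  the integrand remains a polynomial.\<close>

definition legendre_inner :: "nat \<Rightarrow> real poly \<Rightarrow> real poly \<Rightarrow> real" where
  "legendre_inner m p q = polar_integral (one_minus_sq ^ m * (pderiv ^^ m) p * (pderiv ^^ m) q)"

lemma legendre_inner_commute: "legendre_inner m p q = legendre_inner m q p"
  by (simp add: legendre_inner_def mult_ac)

text \<open>Integration by parts in the Sturm-Liouville equation; the boundary terms vanish because
  the weight has a factor 1 - t^2. Only the first argument has to be a Legendre polynomial.\<close>

lemma legendre_inner_Suc:
  "legendre_inner (Suc m) (legendre_poly l) q
    = (real l - real m) * (real l + real m + 1) * legendre_inner m (legendre_poly l) q"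
proof -
  let ?F = "one_minus_sq ^ Suc m * (pderiv ^^ Suc m) (legendre_poly l)"
  let ?c = "(real l - real m) * (real l + real m + 1)"
  have "polar_integral (pderiv (?F * (pderiv ^^ m) q)) = 0"
    unfolding polar_integral_pderiv by simp
  moreover have "pderiv (?F * (pderiv ^^ m) q) = ?F * (pderiv ^^ Suc m) q
      + smult (- ?c) (one_minus_sq ^ m * (pderiv ^^ m) (legendre_poly l) * (pderiv ^^ m) q)"
    unfolding pderiv_mult[of ?F] legendre_sturm_liouville by (simp add: mult_ac del: power_Suc)
  ultimately show ?thesis
    unfolding legendre_inner_def by (simp only: polar_integral_add polar_integral_smult) simp
qed

text \<open>The eigenvalues (l-j)(l+j+1) for j < m multiply to (l+m)! / (l-m)!.\<close>

lemma legendre_inner_reduce: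
  assumes "m \<le> l"
  shows "legendre_inner m (legendre_poly l) q = fact (l + m) / fact (l - m) * legendre_inner 0 (legendre_poly l) q"
  using assms
proof (induction m)
  case (Suc m)
  then have "l - m = Suc (l - Suc m)" by simp
  then have f: "fact (l - m) = (real l - real m) * fact (l - Suc m)"
    using Suc.prems by (simp only: fact_Suc) (simp add: of_nat_diff)
  show ?case
    unfolding legendre_inner_Suc Suc.IH[OF Suc_leD[OF Suc.prems]] f
    using Suc.prems by (simp add: field_simps)
qed simp

text \<open>Raising the order from 0 to 1 can be charged to either argument by symmetry, which
  produces the two distinct eigenvalues l(l+1) and l'(l'+1) in front of the same integral.\<close>

lemma legendre_inner_0_orthogonal:
  assumes "l \<noteq> l'"
  shows "legendre_inner 0 (legendre_poly l) (legendre_poly l') = 0"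
proof -
  have "real l * (real l + 1) * legendre_inner 0 (legendre_poly l) (legendre_poly l')
     = real l' * (real l' + 1) * legendre_inner 0 (legendre_poly l) (legendre_poly l')"
    using legendre_inner_Suc[of 0 l "legendre_poly l'"] legendre_inner_Suc[of 0 l' "legendre_poly l"]
    by (simp add: legendre_inner_commute[of _ "legendre_poly l'"])
  moreover have "real l * (real l + 1) \<noteq> real l' * (real l' + 1)"
  proof
    assume "real l * (real l + 1) = real l' * (real l' + 1)"
    then have "(real l - real l') * (real l + real l' + 1) = 0" by (simp add: algebra_simps)
    moreover have "real l + real l' + 1 \<noteq> 0" by linarith
    ultimately show False using assms by simp
  qed
  ultimately show ?thesis by simp
qed

section \<open>Norms of the Legendre polynomials\<close>

lemma degree_square_minus_one_power: "degree ([:-1, 0, 1::real:] ^ l) = 2 * l"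
  by (simp add: degree_power_eq)

lemma lead_coeff_square_minus_one_power: "coeff ([:-1, 0, 1::real:] ^ l) (2 * l) = 1"
  using lead_coeff_power[of "[:-1, 0, 1::real:]" l] by (simp add: degree_square_minus_one_power)

lemma pderiv_funpow_degree:
  "degree p = n \<Longrightarrow> (pderiv ^^ n) p = [:fact n * lead_coeff (p :: real poly):]"
proof (induction n arbitrary: p)
  case 0
  then show ?case by (auto elim: degree_eq_zeroE)
next
  case (Suc n)
  have deg: "degree (pderiv p) = n"
    using Suc.prems by (simp add: degree_pderiv)
  have "(pderiv ^^ Suc n) p = (pderiv ^^ n) (pderiv p)"
    by (simp only: funpow_Suc_right o_apply)
  also have "\<dots> = [:fact n * lead_coeff (pderiv p):]"
    by (rule Suc.IH[OF deg])
  also have "lead_coeff (pderiv p) = real (Suc n) * lead_coeff p"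
    unfolding deg by (simp add: coeff_pderiv Suc.prems)
  finally show ?case by (simp add: mult_ac)
qed

lemma legendre_poly_top_deriv: "(pderiv ^^ l) (legendre_poly l) = [:fact (2 * l) / (2 ^ l * fact l):]"
proof -
  have "rodrigues l (l + l) = [:fact (2 * l):]"
    using pderiv_funpow_degree[OF degree_square_minus_one_power[of l]]
    by (simp add: degree_square_minus_one_power lead_coeff_square_minus_one_power flip: mult_2)
  then show ?thesis by (simp add: pderiv_legendre_poly)
qed

text \<open>A Beta integral. The recursion comes from t (1 - t^2)^(l+1), which vanishes at both
  endpoints; in its derivative t^2 is rewritten as 1 - (1 - t^2).\<close>

lemma polar_integral_one_minus_sq_power:
  "polar_integral (one_minus_sq ^ l) = 2 * 4 ^ l * (fact l)\<^sup>2 / fact (2 * l + 1)"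
proof (induction l)
  case 0
  show ?case using polar_integral_pderiv[of "[:0, 1:]"] by (simp add: pderiv_pCons one_pCons)
next
  case (Suc l)
  let ?Q = "one_minus_sq"
  have "pderiv ([:0, 1:] * ?Q ^ Suc l) = smult (2 * real l + 3) (?Q ^ Suc l) - smult (2 * real l + 2) (?Q ^ l)"
  proof (rule poly_ext)
    fix x :: real
    have Q: "pderiv ?Q = [:0, -2:]" "pderiv [:0, 1::real:] = 1"
      by (simp_all add: pderiv_pCons one_pCons)
    show "poly (pderiv ([:0, 1:] * ?Q ^ Suc l)) x
        = poly (smult (2 * real l + 3) (?Q ^ Suc l) - smult (2 * real l + 2) (?Q ^ l)) x"
      unfolding pderiv_mult pderiv_power_Suc Q by (simp add: algebra_simps power2_eq_square)
  qed
  then have "(2 * real l + 3) * polar_integral (?Q ^ Suc l) - (2 * real l + 2) * polar_integral (?Q ^ l) = 0"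
    using polar_integral_pderiv[of "[:0, 1:] * ?Q ^ Suc l"]
    by (simp only: polar_integral_diff polar_integral_smult) simp
  moreover have "2 * real l + 3 \<noteq> 0" by linarith
  ultimately have "polar_integral (?Q ^ Suc l) = (2 * real l + 2) / (2 * real l + 3) * polar_integral (?Q ^ l)"
    by (simp only: eq_divide_eq times_divide_eq_left) (simp only: right_minus_eq mult.commute not_False_eq_True if_True)
  also have "\<dots> = (2 * real l + 2) / (2 * real l + 3) * (2 * 4 ^ l * (fact l)\<^sup>2 / fact (2 * l + 1))"
    by (simp only: Suc)
  also have "\<dots> = 2 * 4 ^ Suc l * (fact (Suc l))\<^sup>2 / fact (2 * Suc l + 1)"
  proof -
    have f: "fact (2 * Suc l + 1) = (2 * real l + 3) * ((2 * real l + 2) * fact (2 * l + 1))"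
      by (simp add: algebra_simps)
    have "2 * real l + 3 \<noteq> 0" "2 * real l + 2 \<noteq> 0" by linarith+
    then show ?thesis unfolding f
      by (simp add: divide_simps power2_eq_square) (simp add: algebra_simps)
  qed
  finally show ?case .
qed

text \<open>The order is raised to \<open>m = l\<close>, where the derivatives are constants and
  only the integral of (1 - t^2)^l is left. The factor (2l)! introduced by
  \<open>legendre_inner_reduce\<close> cancels at the end.\<close>

lemma legendre_inner_0_self: "legendre_inner 0 (legendre_poly l) (legendre_poly l) = 2 / (2 * real l + 1)"
proof -
  let ?c = "fact (2 * l) / (2 ^ l * fact l) :: real"
  have "fact (2 * l) * legendre_inner 0 (legendre_poly l) (legendre_poly l)
      = legendre_inner l (legendre_poly l) (legendre_poly l)"
    using legendre_inner_reduce[of l l] by (simp add: mult_2)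
  also have "\<dots> = polar_integral (smult (?c * ?c) (one_minus_sq ^ l))"
    unfolding legendre_inner_def legendre_poly_top_deriv by (simp add: mult_ac)
  also have "\<dots> = ?c * ?c * (2 * 4 ^ l * (fact l)\<^sup>2 / fact (2 * l + 1))"
    by (simp only: polar_integral_smult polar_integral_one_minus_sq_power)
  also have "\<dots> = fact (2 * l) * (2 / (2 * real l + 1))"
  proof -
    have "fact (2 * l + 1) = (2 * real l + 1) * fact (2 * l)" by simp
    moreover have "(4::real) ^ l = 2 ^ l * 2 ^ l" by (simp flip: power_mult_distrib)
    moreover have "2 * real l + 1 \<noteq> 0" by linarith
    ultimately show ?thesis by (simp only:) (simp add: divide_simps power2_eq_square)
  qed
  finally show ?thesis
    using mult_cancel_left[of "fact (2 * l) :: real"] by (simp only: fact_nonzero) blast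
qed

theorem legendre_inner_legendre_poly:
  assumes "m \<le> l"
  shows "legendre_inner m (legendre_poly l) (legendre_poly l')
    = (if l = l' then 2 / (2 * real l + 1) * (fact (l + m) / fact (l - m)) else 0)"
  using legendre_inner_reduce[OF assms, of "legendre_poly l'"] legendre_inner_0_orthogonal legendre_inner_0_self
  by simp

section \<open>The surface measure\<close>

lemma norm_sq_vec3: "(norm (x :: real ^ 3))\<^sup>2 = (x $ 1)\<^sup>2 + (x $ 2)\<^sup>2 + (x $ 3)\<^sup>2"
  by (simp add: norm_vec_def L2_set_def sum_3 add_nonneg_nonneg)

lemma S2_iff: "x \<in> S2 \<longleftrightarrow> (x $ 1)\<^sup>2 + (x $ 2)\<^sup>2 + (x $ 3)\<^sup>2 = 1"
proof -
  have "x \<in> S2 \<longleftrightarrow> (norm x)\<^sup>2 = 1\<^sup>2"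
    by (subst power2_eq_iff_nonneg) (auto simp: dist_norm)
  then show ?thesis by (simp add: norm_sq_vec3)
qed

lemma sph_point_component [simp]:
  "sph_point \<theta> \<phi> $ 1 = sin \<theta> * cos \<phi>" "sph_point \<theta> \<phi> $ 2 = sin \<theta> * sin \<phi>" "sph_point \<theta> \<phi> $ 3 = cos \<theta>"
  by (simp_all add: sph_point_def vector_3)

lemma sph_point_in_S2 [simp]: "sph_point \<theta> \<phi> \<in> S2"
proof -
  have "(sin \<theta>)\<^sup>2 * (cos \<phi>)\<^sup>2 + (sin \<theta>)\<^sup>2 * (sin \<phi>)\<^sup>2 = (sin \<theta>)\<^sup>2"
    by (metis distrib_left mult.right_neutral sin_cos_squared_add2)
  then show ?thesis unfolding S2_iff by (simp add: power_mult_distrib)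
qed

lemma norm_sph_point [simp]: "norm (sph_point \<theta> \<phi>) = 1"
  using sph_point_in_S2[of \<theta> \<phi>] by (simp add: dist_norm)

lemma continuous_on_sph_point [continuous_intros]:
  fixes f g :: "'a :: t2_space \<Rightarrow> real"
  assumes "continuous_on A f" "continuous_on A g"
  shows "continuous_on A (\<lambda>x. sph_point (f x) (g x))"
proof -
  have "sph_point \<theta> \<phi> = (sin \<theta> * cos \<phi>) *\<^sub>R axis 1 1 + (sin \<theta> * sin \<phi>) *\<^sub>R axis 2 1 + cos \<theta> *\<^sub>R axis 3 1"
      for \<theta> \<phi>
    by (simp add: vec_eq_iff forall_3 axis_def)
  then show ?thesis by (simp only:) (intro continuous_intros assms)
qed

lemma S2_eq_sph_point:
  assumes "x \<in> S2"
  obtains \<theta> \<phi> where "\<theta> \<in> {0..pi}" "\<phi> \<in> {0..2 * pi}" "x = sph_point \<theta> \<phi>"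
proof -
  define \<theta> where "\<theta> = arccos (x $ 3)"
  have s: "(x $ 1)\<^sup>2 + (x $ 2)\<^sup>2 + (x $ 3)\<^sup>2 = 1" using assms by (simp only: S2_iff)
  then have "(x $ 3)\<^sup>2 \<le> 1" by (metis le_add_same_cancel2 sum_power2_ge_zero)
  then have b: "\<bar>x $ 3\<bar> \<le> 1" by (simp add: abs_square_le_1)
  then have \<theta>: "\<theta> \<in> {0..pi}" "cos \<theta> = x $ 3"
    unfolding \<theta>_def using arccos_lbound arccos_ubound by (auto simp: abs_le_iff)
  have sn: "sin \<theta> \<ge> 0" using \<theta> by (simp add: sin_ge_zero)
  have xy: "(x $ 1)\<^sup>2 + (x $ 2)\<^sup>2 = (sin \<theta>)\<^sup>2"
    using s sin_cos_squared_add[of \<theta>] \<theta>(2) by simp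
  show ?thesis
  proof (cases "sin \<theta> = 0")
    case True
    with xy have "x $ 1 = 0" "x $ 2 = 0" by (simp_all add: sum_power2_eq_zero_iff)
    then have "x = sph_point \<theta> 0" using \<theta> True by (simp add: vec_eq_iff forall_3)
    with \<theta>(1) that[of \<theta> 0] show ?thesis by simp
  next
    case False
    have "(x $ 1 / sin \<theta>)\<^sup>2 + (x $ 2 / sin \<theta>)\<^sup>2 = 1"
      using xy False by (simp add: power_divide flip: add_divide_distrib)
    then obtain \<phi> where "0 \<le> \<phi>" "\<phi> < 2 * pi" "x $ 1 / sin \<theta> = cos \<phi>" "x $ 2 / sin \<theta> = sin \<phi>"
      using sincos_total_2pi by metis
    then have "x = sph_point \<theta> \<phi>" using \<theta> False by (simp add: vec_eq_iff forall_3 field_simps)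
    with \<theta>(1) \<open>0 \<le> \<phi>\<close> \<open>\<phi> < 2 * pi\<close> that[of \<theta> \<phi>] show ?thesis by simp
  qed
qed

section \<open>Integration over the sphere in angular coordinates\<close>

abbreviation angle_box :: "(real \<times> real) set" where
  "angle_box \<equiv> {0..pi} \<times> {0..2 * pi}"

lemma angle_box_cbox: "angle_box = cbox (0, 0) (pi, 2 * pi)"
  by (simp add: cbox_Pair_eq)

lemma space_sphere_measure [simp]: "space sphere_measure = S2"
  by (simp add: sphere_measure_def space_restrict_space)

lemma sets_sphere_measure [measurable_cong]: "sets sphere_measure = sets (restrict_space borel S2)"
  by (simp add: sphere_measure_def)

lemma borel_measurable_sphere_continuous:
  "continuous_on S2 f \<Longrightarrow> f \<in> borel_measurable sphere_measure"
  using borel_measurable_continuous_on_restrict[of S2 f] measurable_cong_sets[OF sets_sphere_measure refl] by blast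

lemma borel_angle_box [measurable]: "angle_box \<in> sets borel"
  by (intro borel_closed closed_Times) auto

lemma measurable_sph_point:
  "(\<lambda>(\<theta>, \<phi>). sph_point \<theta> \<phi>) \<in> restrict_space lborel angle_box \<rightarrow>\<^sub>M restrict_space borel S2"
proof (rule measurable_restrict_space2)
  show "(\<lambda>(\<theta>, \<phi>). sph_point \<theta> \<phi>) \<in> borel_measurable (restrict_space lborel angle_box)"
  proof (rule measurable_restrict_space1)
    have "(\<lambda>p :: real \<times> real. sph_point (fst p) (snd p)) \<in> borel_measurable borel"
      by (intro borel_measurable_continuous_onI continuous_intros)
    then show "(\<lambda>(\<theta>, \<phi>). sph_point \<theta> \<phi>) \<in> borel_measurable lborel"
      by (simp add: case_prod_beta)
  qed
qed auto

lemma sin_nonneg_angle_box: "p \<in> angle_box \<Longrightarrow> 0 \<le> sin (fst p)"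
  by (auto intro!: sin_ge_zero)

text \<open>The image measure and the density are unfolded into a Lebesgue integral over the angle
  box, which for continuous integrands agrees with the gauge integral. There iterated integration
  and the fundamental theorem of calculus apply directly.\<close>

lemma sphere_integral_continuous:
  fixes f :: "real ^ 3 \<Rightarrow> 'b :: euclidean_space"
  assumes "continuous_on S2 f"
  shows "integrable sphere_measure f"
    and "(LINT x|sphere_measure. f x) = integral angle_box (\<lambda>p. sin (fst p) *\<^sub>R f (sph_point (fst p) (snd p)))"
proof -
  let ?R = "restrict_space lborel angle_box :: (real \<times> real) measure"
  let ?g = "\<lambda>p. sin (fst p) *\<^sub>R f (sph_point (fst p) (snd p))"
  have fm: "f \<in> borel_measurable (restrict_space borel S2)"
    by (rule borel_measurable_continuous_on_restrict[OF assms])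
  have mp: "(\<lambda>(\<theta>, \<phi>). sph_point \<theta> \<phi>) \<in> measurable (density ?R (\<lambda>(\<theta>, \<phi>). ennreal (sin \<theta>))) (restrict_space borel S2)"
    using measurable_sph_point by simp
  have fp: "(\<lambda>p. f (sph_point (fst p) (snd p))) \<in> borel_measurable ?R"
    using measurable_compose[OF measurable_sph_point fm] by (simp add: case_prod_beta)
  have sm: "(\<lambda>p. sin (fst p)) \<in> borel_measurable ?R"
  proof -
    have "(\<lambda>p :: real \<times> real. sin (fst p)) \<in> borel_measurable borel"
      by (intro borel_measurable_continuous_onI continuous_intros)
    then show ?thesis by (simp add: measurable_restrict_space1)
  qed
  \<comment> \<open>The density is \<open>ennreal (sin \<theta>)\<close>, and \<open>ennreal\<close>
    cuts negative values off; the colatitude range is what makes it represent the sine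
    itself.\<close>
  have sn: "AE p in ?R. 0 \<le> sin (fst p)"
    by (rule AE_I2) (simp add: space_restrict_space sin_nonneg_angle_box)
  have dens: "(\<lambda>(\<theta>, \<phi>). ennreal (sin \<theta>)) = (\<lambda>p :: real \<times> real. ennreal (sin (fst p)))"
    by (auto simp: fun_eq_iff)
  have cg: "continuous_on angle_box ?g"
    by (intro continuous_intros continuous_on_compose2[OF assms]) auto
  have bi: "set_integrable lborel angle_box ?g"
    unfolding angle_box_cbox set_integrable_def using cg[unfolded angle_box_cbox]
        by (intro borel_integrable_compact) auto
  have R: "integrable ?R ?g"
    using bi by (simp add: set_integrable_def integrable_restrict_space)
  show "integrable sphere_measure f"
    unfolding sphere_measure_def dens
    by (subst integrable_distr_eq[OF mp[unfolded dens] fm])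
      (use R fp sm sn in \<open>simp add: integrable_density case_prod_beta\<close>)
  have "(LINT x|sphere_measure. f x) = integral\<^sup>L ?R ?g"
    unfolding sphere_measure_def dens
    by (subst integral_distr[OF mp[unfolded dens] fm])
      (use fp sm sn in \<open>simp add: integral_density case_prod_beta\<close>)
  also have "\<dots> = (LINT p:angle_box|lborel. ?g p)"
    by (simp add: integral_restrict_space set_lebesgue_integral_def)
  also have "\<dots> = integral angle_box ?g"
    using set_borel_integral_eq_integral(2)[OF bi] by simp
  finally show "(LINT x|sphere_measure. f x) = integral angle_box ?g" .
qed

lemma finite_measure_sphere: "finite_measure sphere_measure"
proof
  have "integrable sphere_measure (\<lambda>x. 1 :: real)"
    by (rule sphere_integral_continuous) simp
  then show "emeasure sphere_measure (space sphere_measure) \<noteq> \<infinity>"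
    by (auto simp: integrable_iff_bounded)
qed

lemma in_L2_sphere_continuous:
  assumes "continuous_on S2 f"
  shows "in_L2 sphere_measure f"
  unfolding in_L2_def
  using assms by (auto intro!: borel_measurable_sphere_continuous sphere_integral_continuous continuous_intros)

lemma sphere_continuous_eq_0:
  assumes c: "continuous_on S2 (f :: _ \<Rightarrow> complex)" and z: "L2_norm_sq sphere_measure f = 0" and x: "x \<in> S2"
  shows "f x = 0"
proof -
  let ?g = "\<lambda>p. sin (fst p) *\<^sub>R (cmod (f (sph_point (fst p) (snd p))))\<^sup>2"
  have "continuous_on S2 (\<lambda>x. (cmod (f x))\<^sup>2)" by (intro continuous_intros c)
  then have "integral angle_box ?g = 0"
    using sphere_integral_continuous(2)[of "\<lambda>x. (cmod (f x))\<^sup>2"] z by simp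
  moreover have "continuous_on angle_box ?g"
    by (intro continuous_intros continuous_on_compose2[OF c]) auto
  moreover have "box (0, 0) (pi, 2 * pi) \<noteq> {}"
    by (simp add: box_ne_empty Basis_prod_def)
  ultimately have g0: "?g p = 0" if "p \<in> angle_box" for p
    using integral_cbox_eq_0_iff[of "(0, 0)" "(pi, 2 * pi)" ?g] that sin_nonneg_angle_box
    unfolding angle_box_cbox by (metis (no_types, lifting) scaleR_nonneg_nonneg zero_le_power2)
  obtain \<theta> \<phi> where p: "\<theta> \<in> {0..pi}" "\<phi> \<in> {0..2 * pi}" "x = sph_point \<theta> \<phi>"
    using S2_eq_sph_point[OF x] .
  \<comment> \<open>Where the sine vanishes, \<open>g0\<close> carries no information about
    \<open>f\<close>. Those points are reached along the meridian, by continuity from the open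
    interval of colatitudes.\<close>
  have "f (sph_point \<theta> \<phi>) = 0"
  proof (rule continuous_constant_on_closure[of "{0<..<pi}" "\<lambda>\<theta>. f (sph_point \<theta> \<phi>)" 0 \<theta>])
    show "continuous_on (closure {0<..<pi}) (\<lambda>\<theta>. f (sph_point \<theta> \<phi>))"
      by (intro continuous_on_compose2[OF c] continuous_intros) auto
    show "f (sph_point t \<phi>) = 0" if "t \<in> {0<..<pi}" for t
      using g0[of "(t, \<phi>)"] p that sin_gt_zero[of t] by auto
    show "\<theta> \<in> closure {0<..<pi}" using p by simp
  qed
  with p show ?thesis by simp
qed

section \<open>Orthonormality of the spherical harmonics\<close>

definition horiz :: "real ^ 3 \<Rightarrow> complex" where
  "horiz x = Complex (x $ 1) (x $ 2)"

text \<open>On the sphere this is the factor (sin \<theta>)^|m| e^(i m \<phi>) of a harmonic,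
  written as a power of x + iy or of its conjugate. In this form neither the square root nor the
  longitude appears, and continuity at the poles is evident.\<close>

definition sectoral :: "int \<Rightarrow> real ^ 3 \<Rightarrow> complex" where
  "sectoral m x = (if 0 \<le> m then horiz x ^ nat m else cnj (horiz x) ^ nat (- m))"

text \<open>The sign is the Condon-Shortley phase. For negative orders it cancels against the sign
  in the reflection rule that defines them, which leaves 1.\<close>

definition sph_harm_const :: "nat \<Rightarrow> int \<Rightarrow> real" where
  "sph_harm_const l m = sqrt ((2 * real l + 1) / (4 * pi) * (fact (l - nat \<bar>m\<bar>) / fact (l + nat \<bar>m\<bar>)))
     * (if 0 \<le> m then (-1) ^ nat m else 1)"

definition legendre_deriv :: "nat \<Rightarrow> int \<Rightarrow> real poly" where
  "legendre_deriv l m = (pderiv ^^ nat \<bar>m\<bar>) (legendre_poly l)"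

lemma S2_horiz: "x \<in> S2 \<Longrightarrow> horiz x * cnj (horiz x) = of_real (1 - (x $ 3)\<^sup>2)"
  unfolding S2_iff horiz_def by (simp add: complex_eq_iff power2_eq_square algebra_simps)

text \<open>On the sphere the square root of 1 - z^2 is the modulus of x + iy and the longitude is
  its argument, so de Moivre's formula reassembles the power of x + iy. At the poles the modulus is
  0, so the conventional longitude does no harm.\<close>

lemma sph_harm_nonneg_eq:
  assumes "x \<in> S2"
  shows "sph_harm_nonneg l m x = of_real (sqrt ((2 * real l + 1) / (4 * pi) * (fact (l - m) / fact (l + m)))
     * (-1) ^ m * poly ((pderiv ^^ m) (legendre_poly l)) (x $ 3)) * horiz x ^ m"
proof -
  have s: "(x $ 1)\<^sup>2 + (x $ 2)\<^sup>2 + (x $ 3)\<^sup>2 = 1" using assms by (simp only: S2_iff)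
  then have "(x $ 3)\<^sup>2 \<le> 1" by (metis le_add_same_cancel2 sum_power2_ge_zero)
  then have b: "\<bar>x $ 3\<bar> \<le> 1" by (simp add: abs_square_le_1)
  then have c: "cos (colatitude x) = x $ 3" by (simp add: colatitude_def abs_le_iff)
  have r: "sqrt (1 - (x $ 3)\<^sup>2) = cmod (horiz x)"
    using s by (simp add: horiz_def cmod_def algebra_simps)
  have "of_real (cmod (horiz x)) * cis (longitude x) = horiz x"
    using rcis_cmod_Arg[of "horiz x"] by (simp add: rcis_def longitude_def horiz_def)
  then have "of_real (cmod (horiz x)) ^ m * cis (real m * longitude x) = horiz x ^ m"
    by (simp only: Complex.DeMoivre[symmetric] power_mult_distrib[symmetric])
  then show ?thesis
    unfolding sph_harm_nonneg_def assoc_legendre_def c r by (simp add: mult_ac)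
qed

lemma sph_harm_eq:
  assumes "x \<in> S2"
  shows "sph_harm l m x = of_real (sph_harm_const l m * poly (legendre_deriv l m) (x $ 3)) * sectoral m x"
proof (cases "0 \<le> m")
  case True
  then show ?thesis
    by (simp add: sph_harm_def sph_harm_nonneg_eq[OF assms] sph_harm_const_def legendre_deriv_def sectoral_def)
next
  case False
  then have "\<bar>m\<bar> = - m" by simp
  moreover have "(-1) ^ n * ((-1) ^ n * z) = (z :: complex)" for n z
    by (simp flip: mult.assoc power_mult_distrib)
  ultimately show ?thesis using False
    by (simp add: sph_harm_def sph_harm_nonneg_eq[OF assms] sph_harm_const_def legendre_deriv_def sectoral_def mult_ac)
qed

lemma continuous_on_horiz [continuous_intros]: "continuous_on A horiz"
proof -
  have "horiz = (\<lambda>x. of_real (x $ 1) + \<i> * of_real (x $ 2))"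
    by (simp add: fun_eq_iff horiz_def complex_eq_iff)
  then show ?thesis by (rule ssubst) (intro continuous_intros)
qed

lemma continuous_on_sectoral [continuous_intros]: "continuous_on A (sectoral m)"
  unfolding sectoral_def[abs_def] by (cases "0 \<le> m") (auto intro!: continuous_intros)

lemma continuous_on_sph_harm: "continuous_on S2 (sph_harm l m)"
proof -
  have "continuous_on S2 (\<lambda>x. of_real (sph_harm_const l m * poly (legendre_deriv l m) (x $ 3)) * sectoral m x)"
    by (intro continuous_intros)
  then show ?thesis
    by (rule continuous_on_eq) (simp add: sph_harm_eq)
qed

lemma in_L2_sph_harm: "in_L2 sphere_measure (sph_harm l m)"
  by (intro in_L2_sphere_continuous continuous_on_sph_harm)

lemma sectoral_sph_point:
  "sectoral m (sph_point \<theta> \<phi>) = of_real (sin \<theta>) ^ nat \<bar>m\<bar> * cis (of_int m * \<phi>)"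
proof -
  have h: "horiz (sph_point \<theta> \<phi>) = of_real (sin \<theta>) * cis \<phi>"
    by (simp add: horiz_def complex_eq_iff)
  show ?thesis
  proof (cases "0 \<le> m")
    case True
    then show ?thesis by (simp add: sectoral_def h power_mult_distrib Complex.DeMoivre)
  next
    case False
    then have "real (nat (- m)) = - of_int m" by simp
    with False show ?thesis
      by (simp add: sectoral_def h power_mult_distrib cis_cnj Complex.DeMoivre)
  qed
qed

section \<open>Separation of longitude and colatitude\<close>

lemma integral_cis_period:
  fixes k :: int
  shows "integral {0..2 * pi} (\<lambda>\<phi>. cis (of_int k * \<phi>)) = (if k = 0 then of_real (2 * pi) else 0)"
proof (cases "k = 0")
  case False
  have "((\<lambda>\<phi>. cis (of_int k * \<phi>)) has_integral
      (cis (of_int k * (2 * pi)) / (\<i> * of_int k)) - (cis (of_int k * 0) / (\<i> * of_int k))) {0..2 * pi}"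
  proof (rule fundamental_theorem_of_calculus)
    fix \<phi> :: real
    have "((\<lambda>t. exp (\<i> * of_int k * of_real t) / (\<i> * of_int k)) has_vector_derivative
        exp (\<i> * of_int k * of_real \<phi>)) (at \<phi> within {0..2 * pi})"
      using False by (auto intro!: derivative_eq_intros has_vector_derivative_real_field[where f =
          "\<lambda>z. exp (\<i> * of_int k * z) / (\<i> * of_int k)"])
    then show "((\<lambda>\<phi>. cis (of_int k * \<phi>) / (\<i> * of_int k)) has_vector_derivative cis (of_int k * \<phi>))
        (at \<phi> within {0..2 * pi})"
      by (simp add: cis_conv_exp mult_ac)
  qed simp
  moreover have "cis (of_int k * (2 * pi)) = 1"
    by (metis cis_multiple_2pi Ints_of_int mult.commute)
  ultimately show ?thesis using False by (simp add: integral_unique)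
qed (simp add: scaleR_conv_of_real)

lemma angle_box_integral_product:
  assumes "continuous_on {0..pi} g" "continuous_on {0..2 * pi} h"
  shows "integral angle_box (\<lambda>p. of_real (g (fst p)) * h (snd p))
    = of_real (integral {0..pi} g) * (integral {0..2 * pi} h :: complex)"
proof -
  have "continuous_on (cbox (0, 0) (pi, 2 * pi)) (\<lambda>p. of_real (g (fst p)) * h (snd p))"
    unfolding angle_box_cbox[symmetric]
    by (intro continuous_intros continuous_on_compose2[OF assms(1)] continuous_on_compose2[OF assms(2)]) auto
  then have "integral angle_box (\<lambda>p. of_real (g (fst p)) * h (snd p))
     = integral {0..pi} (\<lambda>x. integral {0..2 * pi} (\<lambda>y. of_real (g x) * h y))"
    unfolding angle_box_cbox by (subst integral_prod_continuous) auto
  also have "\<dots> = integral {0..pi} (\<lambda>x. of_real (g x)) * integral {0..2 * pi} h"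
    by simp
  also have "integral {0..pi} (\<lambda>x. of_real (g x)) = (of_real (integral {0..pi} g) :: complex)"
    using integrable_continuous_real[OF assms(1)] integral_linear[of g "{0..pi}" complex_of_real]
    by (simp add: bounded_linear_of_real o_def)
  finally show ?thesis .
qed

text \<open>The longitude integral is 2 pi for equal orders and 0 otherwise. For equal orders the
  two powers of the sine combine into a power of 1 - t^2 at t = cos \<theta>, and the colatitude
  integral becomes \<open>legendre_inner\<close> of order |m|, for which the normalising constants
  are made.\<close>

theorem sph_harm_orthonormal:
  assumes m: "m \<in> {- int l..int l}" and m': "m' \<in> {- int l'..int l'}"
  shows "L2_inner sphere_measure (sph_harm l m) (sph_harm l' m') = (if l = l' \<and> m = m' then 1 else 0)"
proof -
  let ?c = "sph_harm_const l m * sph_harm_const l' m'"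
  let ?p = "legendre_deriv l m" and ?q = "legendre_deriv l' m'"
  let ?g = "\<lambda>\<theta>. sin \<theta> * (?c * sin \<theta> ^ nat \<bar>m\<bar> * sin \<theta> ^ nat \<bar>m'\<bar> * poly ?p (cos \<theta>) * poly ?q (cos \<theta>))"
  have "L2_inner sphere_measure (sph_harm l m) (sph_harm l' m')
    = integral angle_box (\<lambda>p. sin (fst p) *\<^sub>R (sph_harm l m (sph_point (fst p) (snd p)) * cnj (sph_harm l' m' (sph_point (fst p) (snd p)))))"
    by (intro sphere_integral_continuous(2) continuous_intros continuous_on_sph_harm)
  also have "\<dots> = integral angle_box (\<lambda>p. of_real (?g (fst p)) * cis (of_int (m - m') * snd p))"
    by (intro integral_cong)
      (simp add: sph_harm_eq sectoral_sph_point scaleR_conv_of_real cis_cnj cis_mult left_diff_distrib)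
  also have "\<dots> = of_real (integral {0..pi} ?g) * integral {0..2 * pi} (\<lambda>\<phi>. cis (of_int (m - m') * \<phi>))"
    by (intro angle_box_integral_product continuous_intros)
  finally have eq: "L2_inner sphere_measure (sph_harm l m) (sph_harm l' m')
     = of_real (integral {0..pi} ?g) * (if m = m' then of_real (2 * pi) else 0)"
    by (simp only: integral_cis_period right_minus_eq)
  show ?thesis
  proof (cases "m = m'")
    case True
    let ?n = "nat \<bar>m\<bar>"
    have n: "?n \<le> l" "?n \<le> l'" using m m' True by auto
    have "integral {0..pi} ?g = integral {0..pi} (\<lambda>\<theta>. ?c
        * (sin \<theta> * poly (one_minus_sq ^ ?n * ?p * ?q) (cos \<theta>)))"
    proof (rule integral_cong)
      fix \<theta> :: real
      have "poly (one_minus_sq ^ ?n) (cos \<theta>) = (1 - (cos \<theta>)\<^sup>2) ^ ?n"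
        by (simp add: power2_eq_square)
      also have "\<dots> = sin \<theta> ^ ?n * sin \<theta> ^ ?n"
        unfolding sin_squared_eq[symmetric] by (simp only: power2_eq_square power_mult_distrib)
      finally have "poly (one_minus_sq ^ ?n) (cos \<theta>) = sin \<theta> ^ ?n * sin \<theta> ^ ?n" .
      then show "?g \<theta> = ?c * (sin \<theta> * poly (one_minus_sq ^ ?n * ?p * ?q) (cos \<theta>))"
        using True by (simp add: mult_ac)
    qed
    also have "\<dots> = ?c * legendre_inner ?n (legendre_poly l) (legendre_poly l')"
      unfolding legendre_inner_def polar_integral_def legendre_deriv_def True by simp
    finally have i: "integral {0..pi} ?g = ?c * legendre_inner ?n (legendre_poly l) (legendre_poly l')" .
    show ?thesis
    proof (cases "l = l'")
      case True
      have "sph_harm_const l m * sph_harm_const l m = (2 * real l + 1) / (4 * pi)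
          * (fact (l - ?n) / fact (l + ?n))"
        by (simp add: sph_harm_const_def power_mult_distrib power_mult[symmetric] mult.commute[of _ 2] flip:
            power2_eq_square)
      then have "integral {0..pi} ?g * (2 * pi)
          = (2 * real l + 1) / (4 * pi) * (fact (l - ?n) / fact (l + ?n)) * (2 / (2 * real l + 1)
              * (fact (l + ?n) / fact (l - ?n))) * (2 * pi)"
        unfolding i using \<open>m = m'\<close> True legendre_inner_legendre_poly[OF n(1), of l'] by simp
      also have "\<dots> = 1"
      proof -
        have cancel: "a / (4 * pi) * (b / c) * (2 / a * (c / b)) * (2 * pi) = 1"
          if "a \<noteq> 0" "b \<noteq> 0" "c \<noteq> 0" for a b c :: real
          using that by simp
        have "2 * real l + 1 \<noteq> 0" by linarith
        then show ?thesis by (intro cancel) auto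
      qed
      finally have "complex_of_real (integral {0..pi} ?g * (2 * pi)) = 1" by (simp only: of_real_1)
      then show ?thesis unfolding eq using \<open>m = m'\<close> True by (simp only: of_real_mult) simp
    next
      case False
      then show ?thesis unfolding eq i using legendre_inner_legendre_poly[OF n(1), of l'] by simp
    qed
  next
    case False
    then show ?thesis unfolding eq by simp
  qed
qed

section \<open>Completeness of the spherical harmonics\<close>

text \<open>The degree bound is strict, so that a sum over \<open>harmonic_indices L\<close> is
  exactly the partial sum over degrees \<open>k < L\<close> that occurs in
  \<open>L2_sums\<close>.\<close>

abbreviation harmonic_indices :: "nat \<Rightarrow> (nat \<times> int) set" where
  "harmonic_indices L \<equiv> Sigma {..<L} (\<lambda>l. {- int l..int l})"

abbreviation harmonic :: "nat \<times> int \<Rightarrow> real ^ 3 \<Rightarrow> complex" where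
  "harmonic i \<equiv> sph_harm (fst i) (snd i)"

text \<open>The rule \<open>cong\<close> makes membership depend on the values on the sphere alone,
  so that x^2 + y^2 = 1 - z^2 may be used inside the span.\<close>

inductive harmonic_span :: "(real ^ 3 \<Rightarrow> complex) \<Rightarrow> bool" where
  zero: "harmonic_span (\<lambda>x. 0)"
| harm: "m \<in> {- int l..int l} \<Longrightarrow> harmonic_span (sph_harm l m)"
| add: "harmonic_span f \<Longrightarrow> harmonic_span g \<Longrightarrow> harmonic_span (\<lambda>x. f x + g x)"
| scale: "harmonic_span f \<Longrightarrow> harmonic_span (\<lambda>x. c * f x)"
| cong: "harmonic_span f \<Longrightarrow> (\<And>x. x \<in> S2 \<Longrightarrow> f x = g x) \<Longrightarrow> harmonic_span g"

text \<open>One family \<open>c\<close> serves every sufficiently large truncation order. Thus two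
  expansions can be added at a common order, and an approximation found once is available at all
  later orders.\<close>

lemma harmonic_span_expansion:
  assumes "harmonic_span f"
  obtains L c where "\<And>L' x. L' \<ge> L \<Longrightarrow> x \<in> S2 \<Longrightarrow> f x = (\<Sum>i\<in>harmonic_indices L'. c i * harmonic i x)"
  using assms
proof (induction arbitrary: thesis)
  case zero
  show ?case by (rule zero[of 0 "\<lambda>_. 0"]) simp
next
  case (harm m l)
  show ?case
  proof (rule harm(2)[of "Suc l" "\<lambda>i. if i = (l, m) then 1 else 0"])
    fix L' x assume "L' \<ge> Suc l"
    have "(\<Sum>i\<in>harmonic_indices L'. (if i = (l, m) then 1 else 0) * harmonic i x)
       = (\<Sum>i\<in>harmonic_indices L'. if i = (l, m) then sph_harm l m x else 0)"
      by (intro sum.cong) auto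
    then show "sph_harm l m x = (\<Sum>i\<in>harmonic_indices L'. (if i = (l, m) then 1 else 0) * harmonic i x)"
      using \<open>L' \<ge> Suc l\<close> harm(1) by simp
  qed
next
  case (add f g)
  obtain L c where f: "\<And>L' x. L' \<ge> L \<Longrightarrow> x \<in> S2 \<Longrightarrow> f x = (\<Sum>i\<in>harmonic_indices L'. c i * harmonic i x)"
    using add.IH(1) by blast
  obtain L2 c2 where g: "\<And>L' x. L' \<ge> L2 \<Longrightarrow> x \<in> S2 \<Longrightarrow> g x = (\<Sum>i\<in>harmonic_indices L'. c2 i * harmonic i x)"
    using add.IH(2) by blast
  show ?case
  proof (rule add.prems[of "max L L2" "\<lambda>i. c i + c2 i"])
    fix L' x assume "L' \<ge> max L L2" "x \<in> S2"
    with f[of L' x] g[of L' x] show "f x + g x = (\<Sum>i\<in>harmonic_indices L'. (c i + c2 i) * harmonic i x)"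
      by (simp add: distrib_right sum.distrib)
  qed
next
  case (scale f d)
  obtain L c where f: "\<And>L' x. L' \<ge> L \<Longrightarrow> x \<in> S2 \<Longrightarrow> f x = (\<Sum>i\<in>harmonic_indices L'. c i * harmonic i x)"
    using scale.IH by blast
  show ?case
    by (rule scale.prems[of L "\<lambda>i. d * c i"]) (simp add: f sum_distrib_left mult.assoc)
next
  case (cong f g)
  obtain L c where f: "\<And>L' x. L' \<ge> L \<Longrightarrow> x \<in> S2 \<Longrightarrow> f x = (\<Sum>i\<in>harmonic_indices L'. c i * harmonic i x)"
    using cong.IH by blast
  show ?case
    by (rule cong.prems[of L c]) (simp add: f flip: cong.hyps(2))
qed

section \<open>Polynomials on the sphere lie in the span\<close>

lemma degree_legendre_poly: "degree (legendre_poly l) = l"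
  by (simp add: legendre_poly_def degree_higher_pderiv degree_square_minus_one_power)

lemma degree_legendre_deriv: "degree (legendre_deriv l m) = l - nat \<bar>m\<bar>"
  by (simp add: legendre_deriv_def degree_higher_pderiv degree_legendre_poly)

lemma legendre_deriv_nonzero:
  assumes "nat \<bar>m\<bar> \<le> l"
  shows "legendre_deriv l m \<noteq> 0"
proof
  assume 0: "legendre_deriv l m = 0"
  have "(pderiv ^^ l) (legendre_poly l) = (pderiv ^^ (l - nat \<bar>m\<bar>)) (legendre_deriv l m)"
    unfolding legendre_deriv_def using assms by (metis funpow_add le_add_diff_inverse2 o_apply)
  then show False
    by (simp add: 0 legendre_poly_top_deriv)
qed

lemma sph_harm_const_nonzero: "sph_harm_const l m \<noteq> 0"
proof -
  have "2 * real l + 1 \<noteq> 0" by linarith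
  then show ?thesis by (simp add: sph_harm_const_def)
qed

text \<open>Induction on a strict degree bound: for degree \<open>n + |m|\<close> the |m|-th
  derivative of the Legendre polynomial has degree exactly \<open>n\<close>, so subtracting a
  multiple of it removes the top coefficient of \<open>q\<close>.\<close>

lemma harmonic_span_sectoral:
  "(\<And>i. i \<ge> n \<Longrightarrow> coeff q i = 0) \<Longrightarrow> harmonic_span (\<lambda>x. sectoral m x * of_real (poly q (x $ 3)))"
proof (induction n arbitrary: q)
  case 0
  then have "q = 0" by (simp add: poly_eqI)
  then show ?case by (simp add: harmonic_span.zero)
next
  case (Suc n)
  let ?l = "n + nat \<bar>m\<bar>"
  let ?P = "legendre_deriv ?l m"
  have deg: "degree ?P = n" by (simp add: degree_legendre_deriv)
  have lc: "coeff ?P n \<noteq> 0"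
    using legendre_deriv_nonzero[of m ?l] deg by (metis le_add2 leading_coeff_0_iff)
  define d where "d = coeff q n / coeff ?P n"
  let ?r = "q - smult d ?P"
  have r: "harmonic_span (\<lambda>x. sectoral m x * of_real (poly ?r (x $ 3)))"
  proof (rule Suc.IH)
    fix i assume "i \<ge> n"
    then show "coeff ?r i = 0"
      using Suc.prems[of i] lc deg by (cases "i = n") (auto simp: d_def coeff_eq_0)
  qed
  have h: "harmonic_span (\<lambda>x. of_real (d / sph_harm_const ?l m) * sph_harm ?l m x)"
    by (intro harmonic_span.scale harmonic_span.harm) auto
  show ?case
    by (rule harmonic_span.cong[OF harmonic_span.add[OF r h]])
      (use sph_harm_const_nonzero[of ?l m] in \<open>simp add: sph_harm_eq field_simps\<close>)
qed

lemma harmonic_span_sectoral_poly: "harmonic_span (\<lambda>x. sectoral m x * of_real (poly q (x $ 3)))"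
  by (rule harmonic_span_sectoral[of "Suc (degree q)"]) (simp add: coeff_eq_0)

text \<open>The coordinate functions multiply the span into itself; by induction so does every polynomial, and applying it
  to the constant \<open>1\<close> puts all polynomials into the span.\<close>

lemma harmonic_span_multiplier:
  assumes "harmonic_span f"
    and p: "\<And>m. \<exists>k s. \<forall>x\<in>S2. p x * sectoral m x = sectoral k x * of_real (poly s (x $ 3))"
  shows "harmonic_span (\<lambda>x. p x * f x)"
  using assms(1)
proof induction
  case zero
  show ?case by (simp add: harmonic_span.zero)
next
  case (harm m l)
  obtain k s where ks: "\<And>x. x \<in> S2 \<Longrightarrow> p x * sectoral m x = sectoral k x * of_real (poly s (x $ 3))"
    using p by metis
  show ?case
  proof (rule harmonic_span.cong[OF harmonic_span.scale[OF harmonic_span_sectoral_poly]])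
    fix x assume x: "x \<in> S2"
    have "p x * sph_harm l m x = (p x * sectoral m x) * of_real (sph_harm_const l m * poly (legendre_deriv l m) (x $ 3))"
      by (simp add: sph_harm_eq[OF x])
    then show "of_real (sph_harm_const l m) * (sectoral k x * of_real (poly (s * legendre_deriv l m) (x $ 3)))
        = p x * sph_harm l m x"
      by (simp add: ks[OF x])
  qed
next
  case (add f g)
  then show ?case by (simp add: distrib_left harmonic_span.add)
next
  case (scale f c)
  then show ?case using harmonic_span.scale[of "\<lambda>x. p x * f x" c] by (simp add: mult.left_commute)
next
  case (cong f g)
  show ?case by (rule harmonic_span.cong[OF cong.IH]) (simp add: cong.hyps)
qed

text \<open>For negative \<open>m\<close> the factor x + iy meets one of its conjugates, and their
  product is 1 - z^2 on the sphere; this is where the second polynomial comes from.\<close>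

lemma horiz_mult_sectoral:
  assumes "x \<in> S2"
  shows "horiz x * sectoral m x = sectoral (m + 1) x * of_real (poly (if 0
      \<le> m then 1 else one_minus_sq) (x $ 3))"
proof (cases "0 \<le> m")
  case True
  then show ?thesis by (simp add: sectoral_def nat_add_distrib)
next
  case False
  then have n: "nat (- m) = Suc (nat (- (m + 1)))" by simp
  have "sectoral (m + 1) x = cnj (horiz x) ^ nat (- (m + 1))"
    using False by (auto simp: sectoral_def)
  moreover have "horiz x * cnj (horiz x) ^ nat (- m)
      = (horiz x * cnj (horiz x)) * cnj (horiz x) ^ nat (- (m + 1))"
    unfolding n by simp
  ultimately show ?thesis
    unfolding S2_horiz[OF assms] using False by (simp add: sectoral_def power2_eq_square)
qed

lemma cnj_sectoral: "cnj (sectoral m x) = sectoral (- m) x"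
  by (auto simp: sectoral_def)

lemma cnj_horiz_mult_sectoral:
  assumes "x \<in> S2"
  shows "cnj (horiz x) * sectoral m x = sectoral (m - 1) x * of_real (poly (if 0
      \<le> - m then 1 else one_minus_sq) (x $ 3))"
proof -
  have "cnj (horiz x) * sectoral m x = cnj (horiz x * sectoral (- m) x)"
    by (simp add: cnj_sectoral)
  then show ?thesis
    unfolding horiz_mult_sectoral[OF assms] by (simp only: complex_cnj_mult cnj_sectoral complex_cnj_complex_of_real) simp
qed

text \<open>The induction is on the way \<open>p\<close> is built, with \<open>f\<close> arbitrary:
  for a product of polynomials the hypothesis is used twice, the second time on a function that
  already carries one factor.\<close>

lemma harmonic_span_real_polynomial_multiplier:
  assumes "real_polynomial_function p" "harmonic_span f"
  shows "harmonic_span (\<lambda>x. of_real (p x) * f x)"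
  using assms
proof (induction arbitrary: f)
  case (linear p)
  have h: "harmonic_span (\<lambda>x. horiz x * f x)"
    by (rule harmonic_span_multiplier[OF linear(2)]) (intro exI ballI, erule horiz_mult_sectoral)
  have h': "harmonic_span (\<lambda>x. cnj (horiz x) * f x)"
    by (rule harmonic_span_multiplier[OF linear(2)]) (intro exI ballI, erule cnj_horiz_mult_sectoral)
  have z: "harmonic_span (\<lambda>x. of_real (x $ 3) * f x)"
  proof (rule harmonic_span_multiplier[OF linear(2)])
    fix m
    show "\<exists>k s. \<forall>x\<in>S2. complex_of_real (x $ 3) * sectoral m x = sectoral k x * of_real (poly s (x $ 3))"
      by (intro exI[of _ m] exI[of _ "[:0, 1:]"]) simp
  qed
  interpret p: bounded_linear p by fact
  have e: "p x = x $ 1 * p (axis 1 1) + x $ 2 * p (axis 2 1) + x $ 3 * p (axis 3 1)" for x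
  proof -
    have "x = x $ 1 *\<^sub>R axis 1 1 + x $ 2 *\<^sub>R axis 2 1 + x $ 3 *\<^sub>R axis 3 1"
      by (simp add: vec_eq_iff forall_3 axis_def)
    then have "p x = p (x $ 1 *\<^sub>R axis 1 1 + x $ 2 *\<^sub>R axis 2 1 + x $ 3 *\<^sub>R axis 3 1)" by metis
    then show ?thesis by (simp only: p.add p.scaleR real_scaleR_def)
  qed
  let ?a = "complex_of_real (p (axis 1 1))" and ?b = "complex_of_real (p (axis 2 1))" and ?c
      = "complex_of_real (p (axis 3 1))"
  \<comment> \<open>For h = x + iy one has a x + b y = (a - ib)/2 h + (a + ib)/2 cnj h, which
    expresses the linear form through the three multipliers already treated.\<close>
  have "harmonic_span (\<lambda>x. ((?a - \<i> * ?b) / 2 * (horiz x * f x) + (?a + \<i> * ?b) / 2 * (cnj (horiz x) * f x))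
      + ?c * (of_real (x $ 3) * f x))"
    by (intro harmonic_span.add harmonic_span.scale h h' z)
  then show ?case
  proof (rule harmonic_span.cong)
    fix x :: "real ^ 3"
    have e: "of_real (p x) = (?a - \<i> * ?b) / 2 * horiz x
        + (?a + \<i> * ?b) / 2 * cnj (horiz x) + ?c * of_real (x $ 3)"
      unfolding e[of x] horiz_def by (simp add: complex_eq_iff add_divide_distrib diff_divide_distrib algebra_simps)
    then show "((?a - \<i> * ?b) / 2 * (horiz x * f x) + (?a + \<i> * ?b) / 2 * (cnj (horiz x) * f x))
      + ?c * (of_real (x $ 3) * f x) = of_real (p x) * f x"
      unfolding e by (simp only: distrib_right mult.assoc)
  qed
next
  case (const c)
  then show ?case by (rule harmonic_span.scale)
next
  case (add p q)
  then show ?case by (simp add: distrib_right harmonic_span.add)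
next
  case (mult p q)
  then show ?case by (simp add: mult.assoc)
qed

lemma harmonic_span_one: "harmonic_span (\<lambda>x. 1)"
  using harmonic_span_sectoral_poly[of 0 1] by (simp add: sectoral_def)

lemma harmonic_span_real_polynomial: "real_polynomial_function p \<Longrightarrow> harmonic_span (\<lambda>x. of_real (p x))"
  using harmonic_span_real_polynomial_multiplier[OF _ harmonic_span_one] by simp

section \<open>Uniform density, Bessel's inequality and Parseval's identity\<close>

lemma harmonic_span_dense:
  assumes "continuous_on S2 f" "\<epsilon> > 0"
  obtains h where "harmonic_span h" "\<And>x. x \<in> S2 \<Longrightarrow> cmod (f x - h x) < \<epsilon>"
proof -
  have "continuous_on S2 (\<lambda>x. Re (f x))" "continuous_on S2 (\<lambda>x. Im (f x))"
    by (intro continuous_intros assms)+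
  then obtain p q where p: "real_polynomial_function p" "\<And>x. x \<in> S2 \<Longrightarrow> \<bar>Re (f x) - p x\<bar> < \<epsilon> / 2"
    and q: "real_polynomial_function q" "\<And>x. x \<in> S2 \<Longrightarrow> \<bar>Im (f x) - q x\<bar> < \<epsilon> / 2"
    using Stone_Weierstrass_real_polynomial_function[OF compact_sphere] half_gt_zero[OF \<open>\<epsilon> > 0\<close>] by metis
  show ?thesis
  proof
    show "harmonic_span (\<lambda>x. of_real (p x) + \<i> * of_real (q x))"
      by (intro harmonic_span.add harmonic_span.scale harmonic_span_real_polynomial p q)
    fix x assume x: "x \<in> S2"
    have "cmod (f x - (of_real (p x) + \<i> * of_real (q x))) \<le> \<bar>Re (f x) - p x\<bar> + \<bar>Im (f x) - q x\<bar>"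
      using cmod_le[of "f x - (of_real (p x) + \<i> * of_real (q x))"] by simp
    also have "\<dots> < \<epsilon>" using p(2)[OF x] q(2)[OF x] by linarith
    finally show "cmod (f x - (of_real (p x) + \<i> * of_real (q x))) < \<epsilon>" .
  qed
qed

lemma finite_harmonic_indices [simp]: "finite (harmonic_indices L)"
  by auto

lemma harmonic_orthonormal:
  assumes "i \<in> harmonic_indices L" "j \<in> harmonic_indices L"
  shows "L2_inner sphere_measure (harmonic i) (harmonic j) = (if i = j then 1 else 0)"
  using assms sph_harm_orthonormal[of "snd i" "fst i" "snd j" "fst j"] by (auto simp: prod_eq_iff)

lemma sphere_L2_norm_sq_diff:
  assumes "in_L2 sphere_measure f"
  shows "L2_norm_sq sphere_measure (\<lambda>x. f x - (\<Sum>i\<in>harmonic_indices L. c i * harmonic i x))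
    = L2_norm_sq sphere_measure f - (\<Sum>i\<in>harmonic_indices L. (cmod (L2_inner sphere_measure f (harmonic i)))\<^sup>2)
      + (\<Sum>i\<in>harmonic_indices L. (cmod (c i - L2_inner sphere_measure f (harmonic i)))\<^sup>2)"
  by (rule L2_norm_sq_diff_orthonormal[OF assms in_L2_sph_harm finite_harmonic_indices harmonic_orthonormal])

lemma sphere_bessel:
  assumes "in_L2 sphere_measure f"
  shows "(\<Sum>i\<in>harmonic_indices L. (cmod (L2_inner sphere_measure f (harmonic i)))\<^sup>2) \<le>
      L2_norm_sq sphere_measure f"
  using sphere_L2_norm_sq_diff[OF assms, where c = "\<lambda>i. L2_inner sphere_measure f (harmonic i)" and L = L]
    L2_norm_sq_nonneg[of sphere_measure "\<lambda>x. f x - (\<Sum>i\<in>harmonic_indices L.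
        L2_inner sphere_measure f (harmonic i) * harmonic i x)"]
  by simp

text \<open>The deficit in Bessel's inequality is at most the squared distance from \<open>f\<close>
  to any combination of the harmonics involved, hence to a uniform approximation taken from the
  span.\<close>

theorem sphere_parseval:
  assumes c: "continuous_on S2 f"
  shows "(\<lambda>L. \<Sum>i\<in>harmonic_indices L. (cmod (L2_inner sphere_measure f (harmonic i)))\<^sup>2) \<longlonglongrightarrow>
      L2_norm_sq sphere_measure f"
proof (rule LIMSEQ_I)
  fix r :: real assume "r > 0"
  interpret finite_measure sphere_measure by (rule finite_measure_sphere)
  let ?A = "measure sphere_measure S2"
  have f: "in_L2 sphere_measure f" by (rule in_L2_sphere_continuous[OF c])
  \<comment> \<open>A uniform error \<epsilon> costs at most \<epsilon>^2 times the area. The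
    summand 1 makes the division safe without a lower bound on the area.\<close>
  define \<epsilon> where "\<epsilon> = sqrt (r / (?A + 1))"
  have A: "?A + 1 > 0" by (simp add: add_nonneg_pos)
  with \<open>r > 0\<close> have "r / (?A + 1) > 0" by simp
  moreover have "r / (?A + 1) * ?A < r"
    using A \<open>r > 0\<close> by (simp only: times_divide_eq_left pos_divide_less_eq) (simp add: algebra_simps)
  ultimately have \<epsilon>: "\<epsilon> > 0" "\<epsilon>\<^sup>2 * ?A < r"
    by (auto simp: \<epsilon>_def)
  obtain h where h: "harmonic_span h" "\<And>x. x \<in> S2 \<Longrightarrow> cmod (f x - h x) < \<epsilon>"
    using harmonic_span_dense[OF c \<epsilon>(1)] by blast
  obtain L c where Lc: "\<And>L' x. L' \<ge> L \<Longrightarrow> x \<in> S2 \<Longrightarrow> h x = (\<Sum>i\<in>harmonic_indices L'. c i * harmonic i x)"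
    using harmonic_span_expansion[OF h(1)] by blast
  let ?S = "\<lambda>L. \<Sum>i\<in>harmonic_indices L. (cmod (L2_inner sphere_measure f (harmonic i)))\<^sup>2"
  have "norm (?S L' - L2_norm_sq sphere_measure f) < r" if L': "L' \<ge> L" for L'
  proof -
    let ?d = "\<lambda>x. f x - (\<Sum>i\<in>harmonic_indices L'. c i * harmonic i x)"
    have d: "in_L2 sphere_measure ?d"
      by (intro in_L2_diff f in_L2_sum in_L2_mult_const in_L2_sph_harm)
    have "L2_norm_sq sphere_measure f - ?S L' \<le> L2_norm_sq sphere_measure ?d"
      unfolding sphere_L2_norm_sq_diff[OF f] by (simp add: sum_nonneg)
    also have "\<dots> \<le> (LINT x|sphere_measure. \<epsilon>\<^sup>2)"
    proof (rule integral_mono)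
      show "integrable sphere_measure (\<lambda>x. (cmod (?d x))\<^sup>2)" by (rule in_L2_integrable_sq[OF d])
      fix x assume "x \<in> space sphere_measure"
      then have x: "x \<in> S2" by simp
      show "(cmod (?d x))\<^sup>2 \<le> \<epsilon>\<^sup>2"
        using h(2)[OF x] Lc[OF L' x] by (intro power_mono) auto
    qed simp
    also have "\<dots> < r" using \<epsilon>(2) by (simp add: mult.commute)
    finally show ?thesis using sphere_bessel[OF f, of L'] by (simp add: abs_if)
  qed
  then show "\<exists>no. \<forall>n\<ge>no. norm (?S n - L2_norm_sq sphere_measure f) < r" by blast
qed

lemma sphere_continuous_eq_0_if_orthogonal:
  assumes "continuous_on S2 f"
    and "\<And>l m. m \<in> {- int l..int l} \<Longrightarrow> L2_inner sphere_measure f (sph_harm l m) = 0" and "x \<in> S2"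
  shows "f x = 0"
proof -
  have "(\<Sum>i\<in>harmonic_indices L. (cmod (L2_inner sphere_measure f (harmonic i)))\<^sup>2) = 0" for L
    using assms(2) by (intro sum.neutral) auto
  then have "L2_norm_sq sphere_measure f = 0"
    using sphere_parseval[OF assms(1)] by (simp add: LIMSEQ_const_iff)
  then show ?thesis by (rule sphere_continuous_eq_0[OF assms(1) _ assms(3)])
qed

section \<open>Square-integrable fields on the sphere\<close>

context prob_space
begin

interpretation S: finite_measure sphere_measure
  by (rule finite_measure_sphere)

interpretation P: pair_sigma_finite M sphere_measure ..

section \<open>Exchange of expectation and surface integral\<close>

lemma in_L2_product:
  assumes Z: "in_L2 M Z" and g: "in_L2 sphere_measure g"
  shows "in_L2 (M \<Otimes>\<^sub>M sphere_measure) (\<lambda>(\<omega>, x). Z \<omega> * g x)"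
  unfolding in_L2_def
proof
  have [measurable]: "Z \<in> borel_measurable M" "g \<in> borel_measurable sphere_measure"
    using assms by (auto simp: in_L2_def)
  show "(\<lambda>(\<omega>, x). Z \<omega> * g x) \<in> borel_measurable (M \<Otimes>\<^sub>M sphere_measure)" by measurable
  have "integrable (M \<Otimes>\<^sub>M sphere_measure) (\<lambda>p. (cmod (Z (fst p) * g (snd p)))\<^sup>2)"
  proof (rule P.Fubini_integrable)
    show "integrable M (\<lambda>\<omega>. LINT x|sphere_measure. norm ((cmod (Z (fst (\<omega>, x)) * g (snd (\<omega>, x))))\<^sup>2))"
      using Z by (simp add: norm_mult power_mult_distrib in_L2_def)
    show "AE \<omega> in M. integrable sphere_measure (\<lambda>x. (cmod (Z (fst (\<omega>, x)) * g (snd (\<omega>, x))))\<^sup>2)"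
      using g by (simp add: norm_mult power_mult_distrib in_L2_def)
  qed measurable
  then show "integrable (M \<Otimes>\<^sub>M sphere_measure) (\<lambda>p. (cmod (case p of (\<omega>, x) \<Rightarrow> Z \<omega> * g x))\<^sup>2)"
    by (simp add: case_prod_beta)
qed

lemma in_L2_fieldI:
  assumes f: "(\<lambda>(\<omega>, x). f \<omega> x) \<in> borel_measurable (M \<Otimes>\<^sub>M sphere_measure)"
    and s: "\<And>x. x \<in> S2 \<Longrightarrow> in_L2 M (\<lambda>\<omega>. f \<omega> x)" "\<And>x. x \<in> S2 \<Longrightarrow> L2_norm_sq M (\<lambda>\<omega>. f \<omega> x) \<le> B"
  shows "in_L2 (M \<Otimes>\<^sub>M sphere_measure) (\<lambda>(\<omega>, x). f \<omega> x)"
  unfolding in_L2_def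
proof
  note [measurable] = f
  have "(\<integral>\<^sup>+p. norm ((cmod (case p of (\<omega>, x) \<Rightarrow> f \<omega> x))\<^sup>2) \<partial>(M \<Otimes>\<^sub>M sphere_measure))
     = (\<integral>\<^sup>+x. (\<integral>\<^sup>+\<omega>. ennreal ((cmod (f \<omega> x))\<^sup>2) \<partial>M) \<partial>sphere_measure)"
    by (subst P.nn_integral_snd[symmetric]) auto
  also have "\<dots> \<le> (\<integral>\<^sup>+x. ennreal B \<partial>sphere_measure)"
  proof (rule nn_integral_mono)
    fix x assume "x \<in> space sphere_measure"
    then have x: "x \<in> S2" by simp
    have "(\<integral>\<^sup>+\<omega>. ennreal ((cmod (f \<omega> x))\<^sup>2) \<partial>M) = ennreal (L2_norm_sq M (\<lambda>\<omega>. f \<omega> x))"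
      by (intro nn_integral_eq_integral in_L2_integrable_sq s x) auto
    also have "\<dots> \<le> ennreal B" by (intro ennreal_leI s x)
    finally show "(\<integral>\<^sup>+\<omega>. ennreal ((cmod (f \<omega> x))\<^sup>2) \<partial>M) \<le> ennreal B" .
  qed
  also have "\<dots> < \<infinity>"
    using S.emeasure_finite[of S2] by (simp add: ennreal_mult_eq_top_iff less_top[symmetric])
  finally show "integrable (M \<Otimes>\<^sub>M sphere_measure) (\<lambda>p. (cmod (case p of (\<omega>, x) \<Rightarrow> f \<omega> x))\<^sup>2)"
    by (intro integrableI_bounded) measurable
qed (rule f)

lemma field_L2_norm_sq:
  assumes "in_L2 (M \<Otimes>\<^sub>M sphere_measure) (\<lambda>(\<omega>, x). f \<omega> x)"
  shows "L2_norm_sq (M \<Otimes>\<^sub>M sphere_measure) (\<lambda>(\<omega>, x). f \<omega> x) = (LINT x|sphere_measure. L2_norm_sq M (\<lambda>\<omega>. f \<omega> x))"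
    and "L2_norm_sq (M \<Otimes>\<^sub>M sphere_measure) (\<lambda>(\<omega>, x). f \<omega> x) = (LINT \<omega>|M. L2_norm_sq sphere_measure (f \<omega>))"
    and "integrable M (\<lambda>\<omega>. L2_norm_sq sphere_measure (f \<omega>))"
    and "AE \<omega> in M. in_L2 sphere_measure (f \<omega>)"
proof -
  have i: "integrable (M \<Otimes>\<^sub>M sphere_measure) (\<lambda>(\<omega>, x). (cmod (f \<omega> x))\<^sup>2)"
    using in_L2_integrable_sq[OF assms] by (simp add: case_prod_beta')
  have e: "(\<lambda>p. (cmod (case p of (\<omega>, x) \<Rightarrow> f \<omega> x))\<^sup>2) = (\<lambda>(\<omega>, x). (cmod (f \<omega> x))\<^sup>2)"
    by (auto simp: fun_eq_iff)
  show "L2_norm_sq (M \<Otimes>\<^sub>M sphere_measure) (\<lambda>(\<omega>, x). f \<omega> x) = (LINT x|sphere_measure. L2_norm_sq M (\<lambda>\<omega>. f \<omega> x))"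
    unfolding e by (rule P.integral_snd[OF i, symmetric])
  show "L2_norm_sq (M \<Otimes>\<^sub>M sphere_measure) (\<lambda>(\<omega>, x). f \<omega> x) = (LINT \<omega>|M. L2_norm_sq sphere_measure (f \<omega>))"
    unfolding e by (rule P.integral_fst[OF i, symmetric])
  show "integrable M (\<lambda>\<omega>. L2_norm_sq sphere_measure (f \<omega>))"
    by (rule P.integrable_fst[OF i])
  have m: "(\<lambda>(\<omega>, x). f \<omega> x) \<in> borel_measurable (M \<Otimes>\<^sub>M sphere_measure)"
    by (rule in_L2_measurable[OF assms])
  have "AE \<omega> in M. f \<omega> \<in> borel_measurable sphere_measure"
    using measurable_Pair2[OF m] by (intro AE_I2) simp
  with P.AE_integrable_fst[OF i] show "AE \<omega> in M. in_L2 sphere_measure (f \<omega>)"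
    by eventually_elim (simp add: in_L2_def)
qed

text \<open>The first two claims integrate over \<omega> the Cauchy-Schwarz inequality for a path,
  which is available for almost every \<omega>. For the third, Fubini's theorem applies because the
  integrand is the inner product integrand of \<open>f\<close> and the square-integrable product of
  \<open>Z\<close> and \<open>g\<close>.\<close>

lemma field_coeff:
  assumes f: "in_L2 (M \<Otimes>\<^sub>M sphere_measure) (\<lambda>(\<omega>, x). f \<omega> x)" and g: "in_L2 sphere_measure g"
  shows "in_L2 M (\<lambda>\<omega>. L2_inner sphere_measure (f \<omega>) g)"
    and "L2_norm_sq M (\<lambda>\<omega>. L2_inner sphere_measure (f \<omega>) g)
      \<le> L2_norm_sq (M \<Otimes>\<^sub>M sphere_measure) (\<lambda>(\<omega>, x). f \<omega> x) * L2_norm_sq sphere_measure g"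
    and "in_L2 M Z \<Longrightarrow> L2_inner M (\<lambda>\<omega>. L2_inner sphere_measure (f \<omega>) g) Z
      = L2_inner sphere_measure (\<lambda>x. L2_inner M (\<lambda>\<omega>. f \<omega> x) Z) g"
proof -
  note f1 = field_L2_norm_sq[OF f]
  have [measurable]: "(\<lambda>(\<omega>, x). f \<omega> x) \<in> borel_measurable (M \<Otimes>\<^sub>M sphere_measure)" "g \<in>
      borel_measurable sphere_measure"
    using f g by (auto simp: in_L2_def)
  have le: "AE \<omega> in M. (cmod (L2_inner sphere_measure (f \<omega>) g))\<^sup>2 \<le> L2_norm_sq sphere_measure (f \<omega>) *
      L2_norm_sq sphere_measure g"
    using f1(4) by eventually_elim (rule L2_Cauchy_Schwarz[OF _ g])
  have m [measurable]: "(\<lambda>\<omega>. L2_inner sphere_measure (f \<omega>) g) \<in> borel_measurable M" by measurable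
  have i: "integrable M (\<lambda>\<omega>. (cmod (L2_inner sphere_measure (f \<omega>) g))\<^sup>2)"
    by (rule Bochner_Integration.integrable_bound[OF integrable_mult_left[OF f1(3), of "L2_norm_sq sphere_measure g"]])
      (use le in auto)
  then show "in_L2 M (\<lambda>\<omega>. L2_inner sphere_measure (f \<omega>) g)" by (simp add: in_L2_def)
  have "L2_norm_sq M (\<lambda>\<omega>. L2_inner sphere_measure (f \<omega>) g) \<le> (LINT \<omega>|M. L2_norm_sq sphere_measure (f \<omega>) *
      L2_norm_sq sphere_measure g)"
    by (rule integral_mono_AE[OF i integrable_mult_left[OF f1(3)] le])
  then show "L2_norm_sq M (\<lambda>\<omega>. L2_inner sphere_measure (f \<omega>) g)
      \<le> L2_norm_sq (M \<Otimes>\<^sub>M sphere_measure) (\<lambda>(\<omega>, x). f \<omega> x) * L2_norm_sq sphere_measure g"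
    by (simp add: f1(2))
  assume Z: "in_L2 M Z"
  have I: "integrable (M \<Otimes>\<^sub>M sphere_measure) (\<lambda>(\<omega>, x). f \<omega> x * cnj (g x) * cnj (Z \<omega>))"
    using integrable_L2_inner[OF f in_L2_product[OF Z g]] by (simp add: case_prod_beta' mult_ac)
  have "L2_inner M (\<lambda>\<omega>. L2_inner sphere_measure (f \<omega>) g) Z =
      (LINT \<omega>|M. LINT x|sphere_measure. f \<omega> x * cnj (g x) * cnj (Z \<omega>))"
    by simp
  also have "\<dots> = (LINT x|sphere_measure. LINT \<omega>|M. f \<omega> x * cnj (g x) * cnj (Z \<omega>))"
    by (rule P.Fubini_integral[OF I, symmetric])
  also have "\<dots> = (LINT x|sphere_measure. L2_inner M (\<lambda>\<omega>. f \<omega> x) Z * cnj (g x))"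
    by (simp add: mult_ac flip: integral_mult_right_zero)
  finally show "L2_inner M (\<lambda>\<omega>. L2_inner sphere_measure (f \<omega>) g) Z = (LINT x|sphere_measure.
      L2_inner M (\<lambda>\<omega>. f \<omega> x) Z * cnj (g x))" .
qed

end

section \<open>The spectral representation at a fixed point\<close>

lemma continuous_on_S2_bounded:
  assumes "continuous_on S2 (f :: real ^ 3 \<Rightarrow> real)"
  shows "\<exists>B. \<forall>x\<in>S2. f x \<le> B"
proof -
  have "bdd_above (f ` S2)"
    using compact_continuous_image[OF assms compact_sphere] by (intro bounded_imp_bdd_above compact_imp_bounded)
  then show ?thesis unfolding bdd_above_def by blast
qed

abbreviation valid_index :: "nat \<times> int \<Rightarrow> bool" where
  "valid_index i \<equiv> snd i \<in> {- int (fst i)..int (fst i)}"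

lemma valid_indexI: "i \<in> harmonic_indices L \<Longrightarrow> valid_index i"
  by auto

locale spherical_random_field_spectrum = spherical_random_field M T
  for M :: "'w measure" and T :: "'w \<Rightarrow> real ^ 3 \<Rightarrow> real" +
  fixes C :: "nat \<Rightarrow> real"
  assumes spectrum: "angular_power_spectrum M (harmonic_coeff T) C"
begin

section \<open>Covariances of the field with its harmonic coefficients\<close>

abbreviation Tc :: "'w \<Rightarrow> real ^ 3 \<Rightarrow> complex" where
  "Tc \<omega> x \<equiv> complex_of_real (T \<omega> x)"

abbreviation harm_coeff :: "nat \<times> int \<Rightarrow> 'w \<Rightarrow> complex" where
  "harm_coeff i \<equiv> harmonic_coeff T (fst i) (snd i)"

definition cov :: "real ^ 3 \<Rightarrow> real ^ 3 \<Rightarrow> real" where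
  "cov x y = expectation (\<lambda>\<omega>. T \<omega> x * T \<omega> y)"

lemma in_L2_T: "x \<in> S2 \<Longrightarrow> in_L2 M (\<lambda>\<omega>. Tc \<omega> x)"
  using second_order[of x] measurable_Pair1[OF jointly_measurable, of x] by (simp add: in_L2_def)

lemma L2_inner_T: "L2_inner M (\<lambda>\<omega>. Tc \<omega> x) (\<lambda>\<omega>. Tc \<omega> y) = of_real (cov x y)"
  by (simp add: cov_def flip: of_real_mult)

lemma L2_norm_sq_T: "L2_norm_sq M (\<lambda>\<omega>. Tc \<omega> x) = cov x x"
  by (simp add: cov_def power2_eq_square)

lemma continuous_on_cov:
  assumes "continuous_on S2 f" "continuous_on S2 g" "f ` S2 \<subseteq> S2" "g ` S2 \<subseteq> S2"
  shows "continuous_on S2 (\<lambda>x. cov (f x) (g x))"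
proof -
  have "continuous_on S2 (\<lambda>x. (case (f x, g x) of (x, y) \<Rightarrow> expectation (\<lambda>\<omega>. T \<omega> x * T \<omega> y)))"
    by (rule continuous_on_compose2[OF covariance_continuous, of S2 "\<lambda>x. (f x, g x)"])
      (use assms in \<open>auto intro!: continuous_intros\<close>)
  then show ?thesis by (simp add: cov_def)
qed

lemma cov_bounded: "\<exists>B. \<forall>x\<in>S2. cov x x \<le> B"
  by (intro continuous_on_S2_bounded continuous_on_cov continuous_on_id) auto

lemma measurable_deformation:
  assumes "continuous_on S2 U" "U ` S2 \<subseteq> S2"
  shows "U \<in> sphere_measure \<rightarrow>\<^sub>M sphere_measure"
proof -
  have "U \<in> sphere_measure \<rightarrow>\<^sub>M restrict_space borel S2"
    using assms by (intro measurable_restrict_space2 borel_measurable_sphere_continuous) auto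
  then show ?thesis using measurable_cong_sets[OF refl sets_sphere_measure] by blast
qed

lemma in_L2_deformed_field:
  assumes U: "continuous_on S2 U" "U ` S2 \<subseteq> S2"
  shows "in_L2 (M \<Otimes>\<^sub>M sphere_measure) (\<lambda>(\<omega>, x). Tc \<omega> (U x))"
proof -
  have [measurable]: "U \<in> sphere_measure \<rightarrow>\<^sub>M sphere_measure" by (rule measurable_deformation[OF U])
  have "(\<lambda>p. (fst p, U (snd p))) \<in> M \<Otimes>\<^sub>M sphere_measure \<rightarrow>\<^sub>M M \<Otimes>\<^sub>M sphere_measure" by measurable
  from measurable_compose[OF this jointly_measurable]
  have "(\<lambda>p. T (fst p) (U (snd p))) \<in> borel_measurable (M \<Otimes>\<^sub>M sphere_measure)" by simp
  then have m: "(\<lambda>(\<omega>, x). Tc \<omega> (U x)) \<in> borel_measurable (M \<Otimes>\<^sub>M sphere_measure)"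
    by (simp add: case_prod_beta')
  obtain B where B: "\<And>x. x \<in> S2 \<Longrightarrow> cov x x \<le> B" using cov_bounded by blast
  show ?thesis
    by (rule in_L2_fieldI[OF m, of B]) (use U B in_L2_T in \<open>auto simp only: L2_norm_sq_T image_subset_iff\<close>)
qed

lemma in_L2_field: "in_L2 (M \<Otimes>\<^sub>M sphere_measure) (\<lambda>(\<omega>, x). Tc \<omega> x)"
  using in_L2_deformed_field[of "\<lambda>x. x"] by simp

lemma coeff_eq: "harm_coeff i = (\<lambda>\<omega>. L2_inner sphere_measure (Tc \<omega>) (harmonic i))"
  by (simp add: harmonic_coeff_def fun_eq_iff)

lemma in_L2_coeff: "in_L2 M (harm_coeff i)"
  unfolding coeff_eq by (rule field_coeff(1)[OF in_L2_field in_L2_sph_harm])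

lemma L2_inner_coeff:
  "in_L2 M Z \<Longrightarrow> L2_inner M (harm_coeff i) Z = L2_inner sphere_measure (\<lambda>x.
      L2_inner M (\<lambda>\<omega>. Tc \<omega> x) Z) (harmonic i)"
  unfolding coeff_eq by (rule field_coeff(3)[OF in_L2_field in_L2_sph_harm])

lemma coeff_orthogonal:
  assumes "valid_index i" "valid_index j"
  shows "L2_inner M (harm_coeff i) (harm_coeff j) = (if i = j then of_real (C (fst i)) else 0)"
  using spectrum assms unfolding angular_power_spectrum_def by (auto simp: prod_eq_iff)

text \<open>Order 0 is admissible in every degree, and the second moment of that coefficient is
  \<open>C l\<close>.\<close>

lemma C_nonneg: "0 \<le> C l"
proof -
  have "complex_of_real (L2_norm_sq M (harm_coeff (l, 0))) = of_real (C l)"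
    unfolding L2_inner_self[symmetric] using coeff_orthogonal[of "(l, 0)" "(l, 0)"] by simp
  then have "L2_norm_sq M (harm_coeff (l, 0)) = C l" by (simp only: of_real_eq_iff)
  then show ?thesis by (metis L2_norm_sq_nonneg)
qed

text \<open>Mean-square continuity: the squared distance between the field at \<open>u n\<close> and
  at \<open>a\<close> is a combination of three covariances that cancel in the limit.\<close>

lemma continuous_on_L2_inner_T:
  assumes Z: "in_L2 M Z"
  shows "continuous_on S2 (\<lambda>x. L2_inner M (\<lambda>\<omega>. Tc \<omega> x) Z)"
  unfolding continuous_on_sequentially
proof (intro allI ballI impI, elim conjE)
  fix u a assume a: "a \<in> S2" and u: "\<forall>n. u n \<in> S2" and lim: "u \<longlonglongrightarrow> a"
  have cov_lim: "(\<lambda>n. cov (v n) (w n)) \<longlonglongrightarrow> cov a a"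
    if "v \<longlonglongrightarrow> a" "w \<longlonglongrightarrow> a" "\<And>n. v n \<in> S2" "\<And>n. w n \<in> S2" for v w
    using continuous_on_tendsto_compose[OF covariance_continuous tendsto_Pair[OF that(1,2)]] a that(3,4)
    by (simp add: cov_def)
  have "L2_norm_sq M (\<lambda>\<omega>. Tc \<omega> (u n) - Tc \<omega> a) = cov (u n) (u n) - 2 * cov (u n) a + cov a a" for n
    unfolding L2_norm_sq_diff[OF in_L2_T[OF spec[OF u]] in_L2_T[OF a]] L2_inner_T L2_norm_sq_T by simp
  moreover have "(\<lambda>n. cov (u n) (u n) - 2 * cov (u n) a + cov a a) \<longlonglongrightarrow> cov a a - 2 * cov a a + cov a a"
    using u a lim by (intro tendsto_intros cov_lim) auto
  ultimately have "(\<lambda>n. L2_norm_sq M (\<lambda>\<omega>. Tc \<omega> (u n) - Tc \<omega> a)) \<longlonglongrightarrow> 0" by simp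
  then show "((\<lambda>x. L2_inner M (\<lambda>\<omega>. Tc \<omega> x) Z) \<circ> u) \<longlonglongrightarrow> L2_inner M (\<lambda>\<omega>. Tc \<omega> a) Z"
    unfolding o_def using Z in_L2_T u a by (intro L2_inner_tendsto) auto
qed

text \<open>Exchanging expectation and surface integral turns the harmonic coefficients of the left
  side into covariances of harmonic coefficients of the field. By the spectrum and orthonormality
  they agree with those of the right side, and continuity upgrades this to equality at every
  point.\<close>

lemma L2_inner_T_coeff:
  assumes x: "x \<in> S2" and i: "valid_index i"
  shows "L2_inner M (\<lambda>\<omega>. Tc \<omega> x) (harm_coeff i) = of_real (C (fst i)) * harmonic i x"
proof -
  let ?\<phi> = "\<lambda>x. L2_inner M (\<lambda>\<omega>. Tc \<omega> x) (harm_coeff i)"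
  let ?\<psi> = "\<lambda>x. of_real (C (fst i)) * harmonic i x"
  have c: "continuous_on S2 ?\<phi>" "continuous_on S2 ?\<psi>"
    by (intro continuous_on_L2_inner_T in_L2_coeff continuous_intros continuous_on_sph_harm)+
  have "?\<phi> x - ?\<psi> x = 0"
  proof (rule sphere_continuous_eq_0_if_orthogonal[OF continuous_on_diff[OF c] _ x])
    fix l m assume j: "m \<in> {- int l..int l}"
    have "L2_inner sphere_measure (\<lambda>x. ?\<phi> x - ?\<psi> x) (sph_harm l m)
        = L2_inner sphere_measure ?\<phi> (sph_harm l m) - L2_inner sphere_measure ?\<psi> (sph_harm l m)"
      by (intro L2_inner_diff_left in_L2_sphere_continuous c in_L2_sph_harm)
    also have "L2_inner sphere_measure ?\<phi> (sph_harm l m) = L2_inner M (harm_coeff (l, m)) (harm_coeff i)"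
      using L2_inner_coeff[OF in_L2_coeff, of "(l, m)" i] by simp
    also have "L2_inner sphere_measure ?\<psi> (sph_harm l m) = of_real (C (fst i)) *
        L2_inner sphere_measure (harmonic i) (sph_harm l m)"
      by (simp add: mult.assoc)
    also have "L2_inner M (harm_coeff (l, m)) (harm_coeff i) - of_real (C (fst i)) *
        L2_inner sphere_measure (harmonic i) (sph_harm l m) = 0"
      unfolding sph_harm_orthonormal[OF i j] using coeff_orthogonal[of "(l, m)" i] i j
          by (auto simp: prod_eq_iff)
    finally show "L2_inner sphere_measure (\<lambda>x. ?\<phi> x - ?\<psi> x) (sph_harm l m) = 0" .
  qed
  then show ?thesis by simp
qed

section \<open>Truncated expansions at a fixed point\<close>

definition truncation :: "nat \<Rightarrow> 'w \<Rightarrow> real ^ 3 \<Rightarrow> complex" where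
  "truncation L \<omega> x = (\<Sum>i\<in>harmonic_indices L. harmonic i x * harm_coeff i \<omega>)"

definition truncation_error :: "nat \<Rightarrow> real ^ 3 \<Rightarrow> real" where
  "truncation_error L x = L2_norm_sq M (\<lambda>\<omega>. Tc \<omega> x - truncation L \<omega> x)"

lemma in_L2_truncation: "in_L2 M (\<lambda>\<omega>. truncation L \<omega> x)"
  unfolding truncation_def by (intro in_L2_sum in_L2_mult_const in_L2_coeff)

lemma truncation_error_nonneg: "0 \<le> truncation_error L x"
  by (simp add: truncation_error_def)

text \<open>By \<open>L2_inner_T_coeff\<close> the mixed term is twice the quadratic term, so one
  copy survives with a minus sign: the truncation behaves like an orthogonal projection, even where
  some \<open>C l\<close> vanish.\<close>

lemma truncation_error_eq:
  assumes x: "x \<in> S2"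
  shows "truncation_error L x = cov x x - (\<Sum>i\<in>harmonic_indices L. C (fst i) * (cmod (harmonic i x))\<^sup>2)"
proof -
  have "truncation_error L x = L2_norm_sq M (\<lambda>\<omega>. Tc \<omega> x)
      - 2 * (\<Sum>i\<in>harmonic_indices L. Re (cnj (harmonic i x) * L2_inner M (\<lambda>\<omega>. Tc \<omega> x) (harm_coeff i)))
      + (\<Sum>i\<in>harmonic_indices L. (cmod (harmonic i x))\<^sup>2 * C (fst i))"
    unfolding truncation_error_def truncation_def
    by (rule L2_norm_sq_diff_orthogonal[OF in_L2_T[OF x] in_L2_coeff finite_harmonic_indices coeff_orthogonal])
      (auto dest: valid_indexI)
  also have "(\<Sum>i\<in>harmonic_indices L. Re (cnj (harmonic i x) * L2_inner M (\<lambda>\<omega>. Tc \<omega> x) (harm_coeff i)))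
      = (\<Sum>i\<in>harmonic_indices L. C (fst i) * (cmod (harmonic i x))\<^sup>2)"
  proof (rule sum.cong[OF refl])
    fix i assume "i \<in> harmonic_indices L"
    have "cnj (harmonic i x) * L2_inner M (\<lambda>\<omega>. Tc \<omega> x) (harm_coeff i) = of_real (C (fst i))
        * (harmonic i x * cnj (harmonic i x))"
      unfolding L2_inner_T_coeff[OF x valid_indexI[OF \<open>i \<in> harmonic_indices L\<close>]] by (simp only: mult_ac)
    also have "\<dots> = of_real (C (fst i) * (cmod (harmonic i x))\<^sup>2)"
      unfolding complex_norm_square[symmetric] by simp
    finally show "Re (cnj (harmonic i x) * L2_inner M (\<lambda>\<omega>. Tc \<omega> x) (harm_coeff i)) = C (fst i) *
        (cmod (harmonic i x))\<^sup>2"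
      by (simp only: Re_complex_of_real)
  qed
  also have "L2_norm_sq M (\<lambda>\<omega>. Tc \<omega> x) = cov x x" by (rule L2_norm_sq_T)
  finally show ?thesis by (simp add: mult.commute)
qed

lemma truncation_error_le: "x \<in> S2 \<Longrightarrow> truncation_error L x \<le> cov x x"
  unfolding truncation_error_eq by (simp add: sum_nonneg C_nonneg)

lemma weighted_sum_le_cov: "x \<in> S2 \<Longrightarrow> (\<Sum>i\<in>harmonic_indices L. C (fst i) * (cmod (harmonic i x))\<^sup>2) \<le> cov x x"
  using truncation_error_eq[of x L] truncation_error_nonneg[of L x] by simp

lemma harmonic_indices_mono: "L \<le> L' \<Longrightarrow> harmonic_indices L \<subseteq> harmonic_indices L'"
  by auto

text \<open>The residual kernels \<open>g L y = E (T y * cnj (T x - truncation L x))\<close> converge uniformly in \<open>y\<close>; the limit is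
  continuous and orthogonal to all harmonics, hence zero, in particular at \<open>y = x\<close>.\<close>

theorem truncation_error_tendsto_0:
  assumes x: "x \<in> S2"
  shows "(\<lambda>L. truncation_error L x) \<longlonglongrightarrow> 0"
proof -
  obtain B where B: "\<And>y. y \<in> S2 \<Longrightarrow> cov y y \<le> B" using cov_bounded by blast
  have "0 \<le> cov x x" using L2_norm_sq_nonneg[of M "\<lambda>\<omega>. Tc \<omega> x"] unfolding L2_norm_sq_T .
  with B[OF x] have B0: "0 \<le> B" by simp
  define w where "w i = C (fst i) * (cmod (harmonic i x))\<^sup>2" for i
  define s where "s L = (\<Sum>i\<in>harmonic_indices L. w i)" for L
  define t where "t i y = of_real (C (fst i)) * harmonic i y * cnj (harmonic i x)" for i y
  define g where "g L y = L2_inner M (\<lambda>\<omega>. Tc \<omega> y) (\<lambda>\<omega>. Tc \<omega> x - truncation L \<omega> x)" for L y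
  have w0: "w i \<ge> 0" for i by (simp add: w_def C_nonneg)
  have dev: "in_L2 M (\<lambda>\<omega>. Tc \<omega> x - truncation L \<omega> x)" for L
    by (intro in_L2_diff in_L2_T x in_L2_truncation)
  have g_eq: "g L y = of_real (cov y x) - (\<Sum>i\<in>harmonic_indices L. t i y)" if y: "y \<in> S2" for L y
  proof -
    have "L2_inner M (\<lambda>\<omega>. Tc \<omega> y) (\<lambda>\<omega>. truncation L \<omega> x)
        = (\<Sum>i\<in>harmonic_indices L. cnj (harmonic i x) * L2_inner M (\<lambda>\<omega>. Tc \<omega> y) (harm_coeff i))"
      unfolding truncation_def by (rule L2_inner_sum_right[OF in_L2_coeff in_L2_T[OF y]])
    also have "\<dots> = (\<Sum>i\<in>harmonic_indices L. t i y)"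
      by (intro sum.cong refl) (simp only: t_def L2_inner_T_coeff[OF y valid_indexI] mult_ac)
    finally show ?thesis
      unfolding g_def L2_inner_diff_right[OF in_L2_T[OF x] in_L2_truncation in_L2_T[OF y]] L2_inner_T by simp
  qed
  have "incseq s"
    unfolding s_def by (intro incseq_SucI sum_mono2 harmonic_indices_mono w0) auto
  moreover have "s L \<le> cov x x" for L
    unfolding s_def w_def by (rule weighted_sum_le_cov[OF x])
  ultimately have "Cauchy s"
    by (metis LIMSEQ_imp_Cauchy incseq_convergent)
  \<comment> \<open>Writing each \<open>C\<close> as a product of two square roots, Cauchy-Schwarz
    separates the points. The factor in \<open>y\<close> is at most the variance, hence at most
    \<open>B\<close>; the factor in \<open>x\<close> is an increment of \<open>s\<close> and does
    not depend on \<open>y\<close>.\<close>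
  have g_diff: "dist (g L y) (g L' y) \<le> sqrt (B * (s L' - s L))" if y: "y \<in> S2" and L: "L \<le> L'" for L L' y
  proof -
    let ?I = "harmonic_indices L' - harmonic_indices L"
    note sub = harmonic_indices_mono[OF L]
    have "g L y - g L' y = (\<Sum>i\<in>?I. t i y)"
      unfolding g_eq[OF y] using sum.subset_diff[OF sub finite_harmonic_indices, of "\<lambda>i. t i y"] by simp
    then have "dist (g L y) (g L' y) \<le> (\<Sum>i\<in>?I. cmod (t i y))"
      by (simp add: dist_norm norm_sum)
    also have "\<dots> = (\<Sum>i\<in>?I. (sqrt (C (fst i)) * cmod (harmonic i y)) * (sqrt (C (fst i)) * cmod (harmonic i x)))"
    proof (intro sum.cong refl)
      fix i :: "nat \<times> int"
      have "C (fst i) = sqrt (C (fst i)) * sqrt (C (fst i))" by (simp add: C_nonneg)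
      then show "cmod (t i y) = (sqrt (C (fst i)) * cmod (harmonic i y))
          * (sqrt (C (fst i)) * cmod (harmonic i x))"
        by (simp add: t_def norm_mult C_nonneg mult_ac)
    qed
    also have "\<dots> \<le> sqrt (B * (s L' - s L))"
    proof (rule real_le_rsqrt)
      have "(\<Sum>i\<in>?I. (sqrt (C (fst i)) * cmod (harmonic i y)) * (sqrt (C (fst i)) * cmod (harmonic i x)))\<^sup>2
         \<le> (\<Sum>i\<in>?I. (sqrt (C (fst i)) * cmod (harmonic i y))\<^sup>2) *
             (\<Sum>i\<in>?I. (sqrt (C (fst i)) * cmod (harmonic i x))\<^sup>2)"
        by (rule Cauchy_Schwarz_ineq_sum)
      also have "\<dots> = (\<Sum>i\<in>?I. C (fst i) * (cmod (harmonic i y))\<^sup>2) * (\<Sum>i\<in>?I. w i)"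
        by (simp add: power_mult_distrib C_nonneg w_def)
      also have "(\<Sum>i\<in>?I. w i) = s L' - s L"
        unfolding s_def using sum.subset_diff[OF sub finite_harmonic_indices, of w] by simp
      also have "(\<Sum>i\<in>?I. C (fst i) * (cmod (harmonic i y))\<^sup>2) * (s L' - s L) \<le> B * (s L' - s L)"
      proof (rule mult_right_mono)
        have "(\<Sum>i\<in>?I. C (fst i) * (cmod (harmonic i y))\<^sup>2) \<le> (\<Sum>i\<in>harmonic_indices L'. C (fst i) *
            (cmod (harmonic i y))\<^sup>2)"
          by (intro sum_mono2) (auto simp: C_nonneg)
        also have "\<dots> \<le> B" using weighted_sum_le_cov[OF y] B[OF y] by (rule order_trans)
        finally show "(\<Sum>i\<in>?I. C (fst i) * (cmod (harmonic i y))\<^sup>2) \<le> B" .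
        show "0 \<le> s L' - s L" using \<open>incseq s\<close> L by (simp add: incseqD)
      qed
      finally show "(\<Sum>i\<in>?I. (sqrt (C (fst i)) * cmod (harmonic i y))
          * (sqrt (C (fst i)) * cmod (harmonic i x)))\<^sup>2 \<le> B * (s L' - s L)" .
    qed
    finally show ?thesis .
  qed
  have "uniformly_Cauchy_on S2 g"
  proof (rule uniformly_Cauchy_onI')
    fix e :: real assume "e > 0"
    \<comment> \<open>The bound \<open>B\<close> may be 0, so \<open>B + 1\<close> is used as the
      divisor.\<close>
    have B1: "B + 1 > 0" using B0 by simp
    then have "e\<^sup>2 / (B + 1) > 0" using \<open>e > 0\<close> by simp
    then obtain N where N: "\<And>m n. m \<ge> N \<Longrightarrow> n \<ge> N \<Longrightarrow> dist (s m) (s n) < e\<^sup>2 / (B + 1)"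
      using \<open>Cauchy s\<close> unfolding Cauchy_def by blast
    have "dist (g m y) (g n y) < e" if y: "y \<in> S2" and "m \<ge> N" "n > m" for y m n
    proof -
      have d: "0 \<le> s n - s m" "s n - s m < e\<^sup>2 / (B + 1)"
        using N[of m n] incseqD[OF \<open>incseq s\<close>, of m n] that by (auto simp: dist_real_def)
      have "B * (s n - s m) \<le> (B + 1) * (s n - s m)" using d by (intro mult_right_mono) auto
      also have "\<dots> < e\<^sup>2" using d(2) B1 by (simp add: pos_less_divide_eq mult.commute)
      finally have "sqrt (B * (s n - s m)) < e"
        using \<open>e > 0\<close> by (metis real_sqrt_abs real_sqrt_less_iff abs_of_pos)
      with g_diff[OF y, of m n] that show ?thesis by simp
    qed
    then show "\<exists>N. \<forall>y\<in>S2. \<forall>m\<ge>N. \<forall>n>m. dist (g m y) (g n y) < e" by blast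
  qed
  then obtain G where G: "uniform_limit S2 g G sequentially"
    using Cauchy_uniformly_convergent uniformly_convergent_on_def by blast
  have cg: "continuous_on S2 (g L)" for L
    unfolding g_def by (rule continuous_on_L2_inner_T[OF dev])
  then have cG: "continuous_on S2 G"
    using uniform_limit_theorem[OF _ G] by simp
  have lim: "(\<lambda>L. g L y) \<longlonglongrightarrow> G y" if "y \<in> S2" for y
    by (rule tendsto_uniform_limitI[OF G that])
  have gB: "cmod (g L y) \<le> B" if y: "y \<in> S2" for L y
  proof -
    have "(cmod (g L y))\<^sup>2 \<le> cov y y * truncation_error L x"
      using L2_Cauchy_Schwarz[OF in_L2_T[OF y] dev] unfolding g_def truncation_error_def L2_norm_sq_T .
    also have "\<dots> \<le> B * B"
      by (intro mult_mono B y B0 truncation_error_nonneg order_trans[OF truncation_error_le[OF x] B[OF x]])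
    finally have "(cmod (g L y))\<^sup>2 \<le> B\<^sup>2" unfolding power2_eq_square[of B] .
    then show ?thesis using B0 by (rule power2_le_imp_le)
  qed
  have "G x = 0"
  proof (rule sphere_continuous_eq_0_if_orthogonal[OF cG _ x])
    fix l m assume m: "m \<in> {- int l..int l}"
    \<comment> \<open>This inner product equals that of the coefficient \<open>(l, m)\<close> with
      the truncation error variable. Once the degree \<open>l\<close> is included in the truncation,
      the field and its truncation have the same covariance with that coefficient.\<close>
    have "L2_inner sphere_measure (g L) (sph_harm l m) = 0" if L: "L > l" for L
    proof -
      have lm: "(l, m) \<in> harmonic_indices L" using L m by simp
      have "L2_inner sphere_measure (g L) (sph_harm l m) =
          L2_inner M (harm_coeff (l, m)) (\<lambda>\<omega>. Tc \<omega> x - truncation L \<omega> x)"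
        using L2_inner_coeff[OF dev, of "(l, m)"] unfolding g_def by simp
      also have "\<dots> = L2_inner M (harm_coeff (l, m)) (\<lambda>\<omega>. Tc \<omega> x) -
          L2_inner M (harm_coeff (l, m)) (\<lambda>\<omega>. truncation L \<omega> x)"
        by (rule L2_inner_diff_right[OF in_L2_T[OF x] in_L2_truncation in_L2_coeff])
      also have "L2_inner M (harm_coeff (l, m)) (\<lambda>\<omega>. Tc \<omega> x) = of_real (C l) * cnj (sph_harm l m x)"
        using L2_inner_commute[of M "harm_coeff (l, m)"
            "\<lambda>\<omega>. Tc \<omega> x"] L2_inner_T_coeff[OF x, of "(l, m)"] m by simp
      also have "L2_inner M (harm_coeff (l, m)) (\<lambda>\<omega>. truncation L \<omega> x)
          = (\<Sum>i\<in>harmonic_indices L. cnj (harmonic i x) * L2_inner M (harm_coeff (l, m)) (harm_coeff i))"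
        unfolding truncation_def by (rule L2_inner_sum_right[OF in_L2_coeff in_L2_coeff])
      also have "\<dots> = (\<Sum>i\<in>harmonic_indices L. if i = (l, m) then of_real (C l) * cnj (sph_harm l m x) else 0)"
      proof (rule sum.cong[OF refl])
        fix i assume i: "i \<in> harmonic_indices L"
        have vl: "valid_index (l, m)" using m by simp
        note o = coeff_orthogonal[OF vl valid_indexI[OF i]]
        show "cnj (harmonic i x) * L2_inner M (harm_coeff (l, m)) (harm_coeff i)
            = (if i = (l, m) then of_real (C l) * cnj (sph_harm l m x) else 0)"
          unfolding o by (cases "i = (l, m)") (simp_all only: fst_conv snd_conv if_True if_False refl mult_zero_right mult_zero_left mult.commute eq_commute[of "(l, m)"])
      qed
      also have "\<dots> = of_real (C l) * cnj (sph_harm l m x)"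
        unfolding sum.delta[OF finite_harmonic_indices] using lm by (simp only: if_True)
      finally show ?thesis by simp
    qed
    then have "eventually (\<lambda>L. L2_inner sphere_measure (g L) (sph_harm l m) = 0) sequentially"
      using eventually_gt_at_top[of l] by (rule eventually_mono[rotated])
    then have "(\<lambda>L. L2_inner sphere_measure (g L) (sph_harm l m)) \<longlonglongrightarrow> 0"
      by (rule tendsto_eventually)
    moreover have "(\<lambda>L. L2_inner sphere_measure (g L) (sph_harm l m)) \<longlonglongrightarrow>
        L2_inner sphere_measure G (sph_harm l m)"
    proof (rule integral_dominated_convergence[where w = "\<lambda>y. B * cmod (sph_harm l m y)"])
      show "(\<lambda>y. G y * cnj (sph_harm l m y)) \<in> borel_measurable sphere_measure"
        "(\<lambda>y. g L y * cnj (sph_harm l m y)) \<in> borel_measurable sphere_measure" for L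
        by (intro borel_measurable_sphere_continuous continuous_intros cg cG continuous_on_sph_harm)+
      show "integrable sphere_measure (\<lambda>y. B * cmod (sph_harm l m y))"
        by (intro sphere_integral_continuous continuous_intros continuous_on_sph_harm)
      show "AE y in sphere_measure. (\<lambda>L. g L y * cnj (sph_harm l m y)) \<longlonglongrightarrow> G y * cnj (sph_harm l m y)"
        by (intro AE_I2 tendsto_intros lim) simp
      show "AE y in sphere_measure. norm (g L y * cnj (sph_harm l m y)) \<le> B * cmod (sph_harm l m y)" for L
        by (intro AE_I2) (simp add: norm_mult mult_right_mono gB)
    qed
    ultimately show "L2_inner sphere_measure G (sph_harm l m) = 0"
      by (rule LIMSEQ_unique[rotated])
  qed
  with lim[OF x] have "(\<lambda>L. g L x) \<longlonglongrightarrow> 0" by simp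
  \<comment> \<open>On the diagonal the kernel is the error itself: both are \<open>cov x x\<close>
    minus the same weighted sum.\<close>
  moreover have "g L x = of_real (truncation_error L x)" for L
  proof -
    have "t i x = of_real (C (fst i) * (cmod (harmonic i x))\<^sup>2)" for i
      unfolding t_def of_real_mult complex_norm_square by (rule mult.assoc)
    then show ?thesis
      unfolding g_eq[OF x] truncation_error_eq[OF x] by simp
  qed
  ultimately have "(\<lambda>L. complex_of_real (truncation_error L x)) \<longlonglongrightarrow> complex_of_real 0" by simp
  then show ?thesis by (simp only: tendsto_of_real_iff)
qed

end

section \<open>Deformed fields\<close>

context spherical_random_field_spectrum
begin

interpretation S: finite_measure sphere_measure
  by (rule finite_measure_sphere)

context
  fixes U :: "real ^ 3 \<Rightarrow> real ^ 3"
  assumes U: "continuous_on S2 U" "U ` S2 \<subseteq> S2"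
begin

section \<open>Coefficients of the deformed field\<close>

abbreviation Q :: "nat \<times> int \<Rightarrow> nat \<times> int \<Rightarrow> complex" where
  "Q i j \<equiv> Q_coeff U (fst i) (snd i) (fst j) (snd j)"

text \<open>The distinguished version of \<open>b\<close>, computed path by path. On the null set of
  paths that are not square-integrable after deformation its value is immaterial.\<close>

definition deformed_coeff :: "nat \<times> int \<Rightarrow> 'w \<Rightarrow> complex" where
  "deformed_coeff j \<omega> = L2_inner sphere_measure (\<lambda>x. Tc \<omega> (U x)) (harmonic j)"

lemma U_in_S2: "x \<in> S2 \<Longrightarrow> U x \<in> S2"
  using U(2) by blast

lemma continuous_on_harmonic_deformed: "continuous_on S2 (\<lambda>x. harmonic i (U x))"
  by (rule continuous_on_compose2[OF continuous_on_sph_harm U])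

lemma in_L2_harmonic_deformed: "in_L2 sphere_measure (\<lambda>x. harmonic i (U x))"
  by (rule in_L2_sphere_continuous[OF continuous_on_harmonic_deformed])

lemma L2_norm_sq_harmonic: "valid_index j \<Longrightarrow> L2_norm_sq sphere_measure (harmonic j) = 1"
  using L2_inner_self[of sphere_measure "harmonic j"] sph_harm_orthonormal[of "snd j" "fst j" "snd j" "fst j"]
  by (metis of_real_eq_1_iff)

lemma truncation_error_deformed_bounds:
  "\<exists>B. \<forall>L. \<forall>x\<in>S2. truncation_error L (U x) \<le> B"
  using cov_bounded truncation_error_le U_in_S2 order_trans by metis

lemma truncation_error_deformed_integral_tendsto_0:
  "(\<lambda>L. LINT x|sphere_measure. truncation_error L (U x)) \<longlonglongrightarrow> 0"
proof -
  obtain B where B: "\<And>L x. x \<in> S2 \<Longrightarrow> truncation_error L (U x) \<le> B"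
    using truncation_error_deformed_bounds by blast
  have "(\<lambda>L. LINT x|sphere_measure. truncation_error L (U x)) \<longlonglongrightarrow> (LINT x|sphere_measure. 0)"
  proof (rule integral_dominated_convergence[where w = "\<lambda>_. B"])
    \<comment> \<open>The closed formula of \<open>truncation_error_eq\<close> is continuous along
      \<open>U\<close>, which gives measurability.\<close>
    show "(\<lambda>x. truncation_error L (U x)) \<in> borel_measurable sphere_measure" for L
    proof (rule borel_measurable_sphere_continuous)
      have "continuous_on S2 (\<lambda>x. cov (U x) (U x) - (\<Sum>i\<in>harmonic_indices L. C (fst i) *
          (cmod (harmonic i (U x)))\<^sup>2))"
        by (intro continuous_intros continuous_on_cov U continuous_on_harmonic_deformed)
      then show "continuous_on S2 (\<lambda>x. truncation_error L (U x))"
        by (rule continuous_on_eq) (simp only: truncation_error_eq U_in_S2)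
    qed
    show "AE x in sphere_measure. (\<lambda>L. truncation_error L (U x)) \<longlonglongrightarrow> 0"
      using U_in_S2 by (intro AE_I2 truncation_error_tendsto_0) (simp only: space_sphere_measure)
    show "AE x in sphere_measure. norm (truncation_error L (U x)) \<le> B" for L
      using B truncation_error_nonneg by (intro AE_I2) (simp only: space_sphere_measure real_norm_def abs_of_nonneg)
  qed auto
  then show ?thesis by simp
qed

lemma in_L2_deviation:
  "in_L2 (M \<Otimes>\<^sub>M sphere_measure) (\<lambda>(\<omega>, x). Tc \<omega> (U x) - truncation L \<omega> (U x))"
proof -
  have "in_L2 (M \<Otimes>\<^sub>M sphere_measure) (\<lambda>p. \<Sum>i\<in>harmonic_indices L. (case p of (\<omega>, x) \<Rightarrow> harm_coeff i \<omega> * harmonic i (U x)))"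
    by (intro in_L2_sum in_L2_product in_L2_coeff in_L2_harmonic_deformed)
  from in_L2_diff[OF in_L2_deformed_field[OF U] this] show ?thesis
    by (simp add: truncation_def case_prod_beta' mult.commute)
qed

lemma L2_norm_sq_deviation:
  "L2_norm_sq (M \<Otimes>\<^sub>M sphere_measure) (\<lambda>(\<omega>, x). Tc \<omega> (U x) - truncation L \<omega> (U x))
    = (LINT x|sphere_measure. truncation_error L (U x))"
  unfolding truncation_error_def by (rule field_L2_norm_sq(1)[OF in_L2_deviation])

lemma in_L2_deformed_coeff: "in_L2 M (deformed_coeff j)"
  unfolding deformed_coeff_def by (rule field_coeff(1)[OF in_L2_deformed_field[OF U] in_L2_sph_harm])

text \<open>The combination with weights \<open>Q i j\<close> is the \<open>j\<close>-th harmonic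
  coefficient of the deformed truncation, so the difference is a coefficient of the deviation field
  up to sign. As the harmonic has norm 1, its mean square is at most the integrated truncation
  error.\<close>

lemma deformed_coeff_tendsto:
  assumes j: "valid_index j"
  shows "(\<lambda>L. L2_norm_sq M (\<lambda>\<omega>. (\<Sum>i\<in>harmonic_indices L. Q i j * harm_coeff i \<omega>) - deformed_coeff j \<omega>)) \<longlonglongrightarrow> 0"
proof (rule tendsto_sandwich[OF _ _ tendsto_const truncation_error_deformed_integral_tendsto_0])
  show "\<forall>\<^sub>F L in sequentially. L2_norm_sq M (\<lambda>\<omega>. (\<Sum>i\<in>harmonic_indices L. Q i j * harm_coeff i \<omega>) - deformed_coeff j \<omega>)
     \<le> (LINT x|sphere_measure. truncation_error L (U x))"
  proof (intro always_eventually allI)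
    fix L
    let ?dev = "\<lambda>\<omega> x. Tc \<omega> (U x) - truncation L \<omega> (U x)"
    have p: "(\<Sum>i\<in>harmonic_indices L. Q i j * harm_coeff i \<omega>) =
        L2_inner sphere_measure (\<lambda>x. truncation L \<omega> (U x)) (harmonic j)" for \<omega>
      using L2_inner_sum_left[of "harmonic_indices L" sphere_measure "\<lambda>i x. harmonic i (U x)" "harmonic j"
          "\<lambda>i. harm_coeff i \<omega>"]
        in_L2_harmonic_deformed in_L2_sph_harm
      by (simp add: truncation_def Q_coeff_def mult.commute)
    have tr: "in_L2 sphere_measure (\<lambda>x. truncation L \<omega> (U x))" for \<omega>
      using in_L2_sum[of "harmonic_indices L" sphere_measure "\<lambda>i x. harm_coeff i \<omega> * harmonic i (U x)"]
        in_L2_mult_const[OF in_L2_harmonic_deformed]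
      by (simp add: truncation_def mult.commute)
    \<comment> \<open>Splitting the inner product of a difference needs a square-integrable deformed
      path, which holds for almost every \<omega>.\<close>
    have "AE \<omega> in M. (cmod ((\<Sum>i\<in>harmonic_indices L. Q i j * harm_coeff i \<omega>) - deformed_coeff j \<omega>))\<^sup>2
        = (cmod (L2_inner sphere_measure (?dev \<omega>) (harmonic j)))\<^sup>2"
      using field_L2_norm_sq(4)[OF in_L2_deformed_field[OF U]]
    proof eventually_elim
      case (elim \<omega>)
      show ?case
        unfolding p deformed_coeff_def L2_inner_diff_left[OF elim tr in_L2_sph_harm]
            by (simp only: norm_minus_commute)
    qed
    then have "L2_norm_sq M (\<lambda>\<omega>. (\<Sum>i\<in>harmonic_indices L. Q i j * harm_coeff i \<omega>) - deformed_coeff j \<omega>)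
       = L2_norm_sq M (\<lambda>\<omega>. L2_inner sphere_measure (?dev \<omega>) (harmonic j))"
      using in_L2_measurable[OF in_L2_deformed_coeff] in_L2_measurable[OF in_L2_coeff]
        in_L2_measurable[OF field_coeff(1)[OF in_L2_deviation[of L] in_L2_sph_harm[of "fst j" "snd j"]]]
      by (intro integral_cong_AE) auto
    also have "\<dots> \<le> (LINT x|sphere_measure. truncation_error L (U x)) * L2_norm_sq sphere_measure (harmonic j)"
      unfolding L2_norm_sq_deviation[symmetric] by (rule field_coeff(2)[OF in_L2_deviation in_L2_sph_harm])
    finally show "L2_norm_sq M (\<lambda>\<omega>. (\<Sum>i\<in>harmonic_indices L. Q i j * harm_coeff i \<omega>) - deformed_coeff j \<omega>)
       \<le> (LINT x|sphere_measure. truncation_error L (U x))"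
      by (simp add: L2_norm_sq_harmonic[OF j])
  qed
qed (simp add: always_eventually)

lemma sum_harmonic_indices: "(\<Sum>l<L. \<Sum>m\<in>{- int l..int l}. f l m) = (\<Sum>i\<in>harmonic_indices L. f (fst i) (snd i))"
  by (simp add: sum.Sigma case_prod_beta')

lemma deformed_coeff_sums:
  assumes j: "valid_index j"
  shows "L2_sums M (\<lambda>l \<omega>. \<Sum>m\<in>{- int l..int l}. Q_coeff U l m (fst j) (snd j) * harmonic_coeff T l m \<omega>) (deformed_coeff j)"
  unfolding L2_sums_def sum_harmonic_indices
  using deformed_coeff_tendsto[OF j] in_L2_deformed_coeff in_L2_coeff[of "(l, m)" for l m]
  by (auto intro!: in_L2_sum in_L2_mult_const)

lemma deformed_coeff_unique:
  assumes j: "valid_index j"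
    and b: "L2_sums M (\<lambda>l \<omega>. \<Sum>m\<in>{- int l..int l}. Q_coeff U l m (fst j) (snd j) * harmonic_coeff T l m \<omega>) b"
  shows "AE \<omega> in M. b \<omega> = deformed_coeff j \<omega>"
proof (rule L2_limit_unique)
  show "in_L2 M (\<lambda>\<omega>. \<Sum>i\<in>harmonic_indices L. Q i j * harm_coeff i \<omega>)" for L
    by (intro in_L2_sum in_L2_mult_const in_L2_coeff)
  show "(\<lambda>L. L2_norm_sq M (\<lambda>\<omega>. (\<Sum>i\<in>harmonic_indices L. Q i j * harm_coeff i \<omega>) - b \<omega>)) \<longlonglongrightarrow> 0"
    using b unfolding L2_sums_def sum_harmonic_indices by simp
  show "in_L2 M b" using b by (simp add: L2_sums_def)
qed (rule in_L2_deformed_coeff, rule deformed_coeff_tendsto[OF j])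

text \<open>Pairing with the constant variable 1 makes the exchange formula of
  \<open>field_coeff\<close> applicable; the inner expectation then vanishes at every point
  \<open>U x\<close>.\<close>

lemma expectation_deformed_coeff: "expectation (deformed_coeff j) = 0"
proof -
  have one: "in_L2 M (\<lambda>\<omega>. 1)" by (simp add: in_L2_def)
  have "(LINT \<omega>|M. deformed_coeff j \<omega>) = L2_inner M (\<lambda>\<omega>.
      L2_inner sphere_measure (\<lambda>x. Tc \<omega> (U x)) (harmonic j)) (\<lambda>\<omega>. 1)"
    by (simp add: deformed_coeff_def)
  also have "\<dots> = L2_inner sphere_measure (\<lambda>x. L2_inner M (\<lambda>\<omega>. Tc \<omega> (U x)) (\<lambda>\<omega>. 1)) (harmonic j)"
    by (rule field_coeff(3)[OF in_L2_deformed_field[OF U] in_L2_sph_harm one])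
  also have "\<dots> = (LINT x|sphere_measure. 0)"
  proof (rule Bochner_Integration.integral_cong[OF refl])
    fix x assume "x \<in> space sphere_measure"
    then have "expectation (\<lambda>\<omega>. T \<omega> (U x)) = 0" by (intro zero_mean U_in_S2) (simp only: space_sphere_measure)
    then show "L2_inner M (\<lambda>\<omega>. Tc \<omega> (U x)) (\<lambda>\<omega>. 1) * cnj (harmonic j x) = 0" by simp
  qed
  finally show ?thesis by simp
qed

text \<open>Inner products pass to the mean-square limit, and for partial sums the orthogonality of
  the field's coefficients collapses the double sum to its diagonal.\<close>

lemma covariance_deformed_coeff:
  assumes j: "valid_index j" "valid_index j'"
  shows "(\<lambda>k. of_real (C k) * (\<Sum>n\<in>{- int k..int k}. Q (k, n) j * cnj (Q (k, n) j')))
    sums L2_inner M (deformed_coeff j) (deformed_coeff j')"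
proof -
  let ?P = "\<lambda>j L \<omega>. \<Sum>i\<in>harmonic_indices L. Q i j * harm_coeff i \<omega>"
  have P: "in_L2 M (?P j L)" for j L
    by (intro in_L2_sum in_L2_mult_const in_L2_coeff)
  have "(\<lambda>L. L2_inner M (?P j L) (?P j' L)) \<longlonglongrightarrow> L2_inner M (deformed_coeff j) (deformed_coeff j')"
    by (intro L2_inner_tendsto P in_L2_deformed_coeff deformed_coeff_tendsto j)
  moreover have "L2_inner M (?P j L) (?P j' L)
      = (\<Sum>k<L. of_real (C k) * (\<Sum>n\<in>{- int k..int k}. Q (k, n) j * cnj (Q (k, n) j')))" for L
  proof -
    have "L2_inner M (?P j L) (?P j' L) = (\<Sum>i\<in>harmonic_indices L. Q i j * L2_inner M (harm_coeff i) (?P j' L))"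
      by (rule L2_inner_sum_left[OF in_L2_coeff P])
    also have "\<dots> = (\<Sum>i\<in>harmonic_indices L. of_real (C (fst i)) * (Q i j * cnj (Q i j')))"
    proof (rule sum.cong[OF refl])
      fix i assume i: "i \<in> harmonic_indices L"
      have "L2_inner M (harm_coeff i) (?P j' L) = (\<Sum>i'\<in>harmonic_indices L. cnj (Q i' j') *
          L2_inner M (harm_coeff i) (harm_coeff i'))"
        by (rule L2_inner_sum_right[OF in_L2_coeff in_L2_coeff])
      also have "\<dots> = (\<Sum>i'\<in>harmonic_indices L. if i' = i then cnj (Q i j') * of_real (C (fst i)) else 0)"
        using coeff_orthogonal[OF valid_indexI[OF i] valid_indexI] by (intro sum.cong refl) auto
      also have "\<dots> = cnj (Q i j') * of_real (C (fst i))"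
        using i by (subst sum.delta) auto
      finally show "Q i j * L2_inner M (harm_coeff i) (?P j' L) = of_real (C (fst i)) * (Q i j * cnj (Q i j'))"
        by (simp add: mult_ac)
    qed
    also have "\<dots> = (\<Sum>k<L. of_real (C k) * (\<Sum>n\<in>{- int k..int k}. Q (k, n) j * cnj (Q (k, n) j')))"
      unfolding sum_distrib_left by (simp add: sum_harmonic_indices)
    finally show ?thesis .
  qed
  ultimately show ?thesis unfolding sums_def by simp
qed

definition harmonic_energy :: "nat \<Rightarrow> real" where
  "harmonic_energy k = C k * (\<Sum>n\<in>{- int k..int k}. L2_norm_sq sphere_measure (\<lambda>x. sph_harm k n (U x)))"

text \<open>Each bracket is the squared distance from a deformed harmonic of degree \<open>k\<close>
  to the span of the harmonics of degree below \<open>L\<close>; weighted by \<open>C k\<close>,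
  this is the part of the energy of degree \<open>k\<close> that those harmonics miss.\<close>

definition harmonic_residual :: "nat \<Rightarrow> nat \<Rightarrow> real" where
  "harmonic_residual k L = C k * (\<Sum>n\<in>{- int k..int k}. L2_norm_sq sphere_measure (\<lambda>x. sph_harm k n (U x))
      - (\<Sum>j\<in>harmonic_indices L. (cmod (Q (k, n) j))\<^sup>2))"

text \<open>Integrating \<open>truncation_error_eq\<close> along \<open>U\<close> shows that the
  integrated truncation error is the total energy minus a partial sum of this series, and that error
  tends to 0.\<close>

lemma harmonic_energy_sums:
  "harmonic_energy sums L2_norm_sq (M \<Otimes>\<^sub>M sphere_measure) (\<lambda>(\<omega>, x). Tc \<omega> (U x))"
proof -
  let ?R = "LINT x|sphere_measure. cov (U x) (U x)"
  have R: "L2_norm_sq (M \<Otimes>\<^sub>M sphere_measure) (\<lambda>(\<omega>, x). Tc \<omega> (U x)) = ?R"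
    unfolding field_L2_norm_sq(1)[OF in_L2_deformed_field[OF U]] L2_norm_sq_T ..
  have e: "(LINT x|sphere_measure. truncation_error L (U x)) = ?R - (\<Sum>k<L. harmonic_energy k)" for L
  proof -
    have "(LINT x|sphere_measure. truncation_error L (U x))
       = (LINT x|sphere_measure. cov (U x) (U x) - (\<Sum>i\<in>harmonic_indices L. C (fst i) *
           (cmod (harmonic i (U x)))\<^sup>2))"
      by (rule Bochner_Integration.integral_cong[OF refl]) (simp only: space_sphere_measure truncation_error_eq U_in_S2)
    also have "\<dots> = ?R - (LINT x|sphere_measure. (\<Sum>i\<in>harmonic_indices L. C (fst i) *
        (cmod (harmonic i (U x)))\<^sup>2))"
      by (intro Bochner_Integration.integral_diff sphere_integral_continuous(1) continuous_intros
          continuous_on_cov U continuous_on_harmonic_deformed)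
    also have "(LINT x|sphere_measure. (\<Sum>i\<in>harmonic_indices L. C (fst i) * (cmod (harmonic i (U x)))\<^sup>2))
       = (\<Sum>i\<in>harmonic_indices L. C (fst i) * L2_norm_sq sphere_measure (\<lambda>x. harmonic i (U x)))"
      using in_L2_integrable_sq[OF in_L2_harmonic_deformed] by simp
    also have "\<dots> = (\<Sum>k<L. harmonic_energy k)"
      unfolding harmonic_energy_def sum_distrib_left sum_harmonic_indices ..
    finally show ?thesis .
  qed
  have "(\<lambda>L. ?R - (LINT x|sphere_measure. truncation_error L (U x))) \<longlonglongrightarrow> ?R - 0"
    by (intro tendsto_intros truncation_error_deformed_integral_tendsto_0)
  then show ?thesis unfolding sums_def R e by simp
qed

lemma Q_inner: "Q (k, n) j = L2_inner sphere_measure (\<lambda>x. sph_harm k n (U x)) (harmonic j)"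
  by (simp add: Q_coeff_def)

lemma harmonic_residual_bounds: "0 \<le> harmonic_residual k L" "harmonic_residual k L \<le> harmonic_energy k"
proof -
  show "0 \<le> harmonic_residual k L"
    unfolding harmonic_residual_def Q_inner
    using sphere_bessel[OF in_L2_harmonic_deformed[of "(k, n)" for n]]
    by (intro mult_nonneg_nonneg C_nonneg sum_nonneg) simp
  show "harmonic_residual k L \<le> harmonic_energy k"
    unfolding harmonic_residual_def harmonic_energy_def
    by (intro mult_left_mono C_nonneg sum_mono) (simp add: sum_nonneg)
qed

lemma harmonic_residual_tendsto_0: "(\<lambda>L. harmonic_residual k L) \<longlonglongrightarrow> 0"
proof -
  have "(\<lambda>L. harmonic_residual k L) \<longlonglongrightarrow> C k * (\<Sum>n\<in>{- int k..int k}.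
      L2_norm_sq sphere_measure (\<lambda>x. sph_harm k n (U x))
      - L2_norm_sq sphere_measure (\<lambda>x. sph_harm k n (U x)))"
    unfolding harmonic_residual_def Q_inner
    using sphere_parseval[OF continuous_on_harmonic_deformed[of "(k, n)" for n]] by (intro tendsto_intros) simp
  then show ?thesis by simp
qed

text \<open>The series for the second moments of the finitely many coefficients \<open>j\<close> are
  subtracted termwise from the energy series; exchanging finite sums groups what remains by the
  source degree \<open>k\<close>.\<close>

lemma deformed_field_residual:
  "(\<lambda>k. harmonic_residual k L) sums
    (L2_norm_sq (M \<Otimes>\<^sub>M sphere_measure) (\<lambda>(\<omega>, x). Tc \<omega> (U x)) - (\<Sum>j\<in>harmonic_indices L.
        L2_norm_sq M (deformed_coeff j)))"
proof -
  have "(\<lambda>k. C k * (\<Sum>n\<in>{- int k..int k}. (cmod (Q (k, n) j))\<^sup>2)) sums L2_norm_sq M (deformed_coeff j)"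
    if j: "j \<in> harmonic_indices L" for j
  proof -
    have "(\<lambda>k. complex_of_real (C k * (\<Sum>n\<in>{- int k..int k}. (cmod (Q (k, n) j))\<^sup>2)))
        sums of_real (L2_norm_sq M (deformed_coeff j))"
      using covariance_deformed_coeff[OF valid_indexI[OF j] valid_indexI[OF j]]
      unfolding L2_inner_self unfolding complex_norm_square[symmetric] by simp
    then show ?thesis by (simp only: sums_of_real_iff)
  qed
  then have "(\<lambda>k. harmonic_energy k - (\<Sum>j\<in>harmonic_indices L. C k * (\<Sum>n\<in>{- int k..int k}.
      (cmod (Q (k, n) j))\<^sup>2))) sums
    (L2_norm_sq (M \<Otimes>\<^sub>M sphere_measure) (\<lambda>(\<omega>, x). Tc \<omega> (U x)) - (\<Sum>j\<in>harmonic_indices L.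
        L2_norm_sq M (deformed_coeff j)))"
    by (intro sums_diff sums_sum harmonic_energy_sums)
  moreover have "harmonic_energy k - (\<Sum>j\<in>harmonic_indices L. C k * (\<Sum>n\<in>{- int k..int k}. (cmod (Q (k, n) j))\<^sup>2))
     = harmonic_residual k L" for k
  proof -
    have "(\<Sum>j\<in>harmonic_indices L. C k * (\<Sum>n\<in>{- int k..int k}. (cmod (Q (k, n) j))\<^sup>2))
        = C k * (\<Sum>n\<in>{- int k..int k}. \<Sum>j\<in>harmonic_indices L. (cmod (Q (k, n) j))\<^sup>2)"
      unfolding sum_distrib_left[symmetric] by (subst sum.swap) (rule refl)
    then show ?thesis
      unfolding harmonic_energy_def harmonic_residual_def sum_subtractf right_diff_distrib by simp
  qed
  ultimately show ?thesis by simp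
qed

lemma deformed_field_residual_tendsto_0:
  "(\<lambda>L. L2_norm_sq (M \<Otimes>\<^sub>M sphere_measure) (\<lambda>(\<omega>, x). Tc \<omega> (U x)) - (\<Sum>j\<in>harmonic_indices L.
      L2_norm_sq M (deformed_coeff j)))
    \<longlonglongrightarrow> 0"
proof -
  have "(\<lambda>L. \<Sum>k. harmonic_residual k L) \<longlonglongrightarrow> (\<Sum>k. 0)"
  proof (rule tannerys_theorem[THEN conjunct2, THEN conjunct2])
    \<comment> \<open>The majorant does not involve \<open>L\<close>, and it is summable because its
      sum is the finite energy of the deformed field.\<close>
    show "\<forall>\<^sub>F (k, L) in sequentially \<times>\<^sub>F sequentially. norm (harmonic_residual k L) \<le> harmonic_energy k"
      using harmonic_residual_bounds by (intro always_eventually) auto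
  qed (use harmonic_residual_tendsto_0 harmonic_energy_sums in \<open>auto simp: sums_iff\<close>)
  then show ?thesis
    unfolding sums_unique[OF deformed_field_residual, symmetric] by simp
qed

text \<open>For almost every \<omega> the finitely many coefficients in a partial sum agree with
  those of the deformed path, so the path error is its energy minus the squared moduli of these
  coefficients. Taking expectations turns this into the residual that was shown to vanish.\<close>

theorem deformed_field_expansion:
  assumes b: "\<And>j. valid_index j \<Longrightarrow> in_L2 M (b (fst j) (snd j))"
    "\<And>j. valid_index j \<Longrightarrow> AE \<omega> in M. b (fst j) (snd j) \<omega> = deformed_coeff j \<omega>"
  shows "L2_sums (M \<Otimes>\<^sub>M sphere_measure)
          (\<lambda>l (\<omega>, x). \<Sum>m\<in>{- int l..int l}. b l m \<omega> * sph_harm l m x) (\<lambda>(\<omega>, x). Tc \<omega> (U x))"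
proof -
  have summand: "in_L2 (M \<Otimes>\<^sub>M sphere_measure) (\<lambda>(\<omega>, x). b (fst j) (snd j) \<omega> * harmonic j x)" if "valid_index j"
      for j
    by (intro in_L2_product b that in_L2_sph_harm)
  have "in_L2 (M \<Otimes>\<^sub>M sphere_measure) (\<lambda>(\<omega>, x). \<Sum>m\<in>{- int l..int l}. b l m \<omega> * sph_harm l m x)" for l
  proof -
    have "in_L2 (M \<Otimes>\<^sub>M sphere_measure) (\<lambda>p. \<Sum>m\<in>{- int l..int l}. (case p of (\<omega>, x) \<Rightarrow> b l m \<omega> * sph_harm l m x))"
      using summand[of "(l, m)" for m] by (intro in_L2_sum) simp
    then show ?thesis by (simp add: case_prod_beta')
  qed
  moreover have "L2_norm_sq (M \<Otimes>\<^sub>M sphere_measure)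
      (\<lambda>p. (\<Sum>l<L. case p of (\<omega>, x) \<Rightarrow> \<Sum>m\<in>{- int l..int l}. b l m \<omega> * sph_harm l m x)
          - (case p of (\<omega>, x) \<Rightarrow> Tc \<omega> (U x)))
    = L2_norm_sq (M \<Otimes>\<^sub>M sphere_measure) (\<lambda>(\<omega>, x). Tc \<omega> (U x)) - (\<Sum>j\<in>harmonic_indices L.
        L2_norm_sq M (deformed_coeff j))" for L
  proof -
    let ?s = "\<lambda>\<omega> x. \<Sum>j\<in>harmonic_indices L. b (fst j) (snd j) \<omega> * harmonic j x"
    have "in_L2 (M \<Otimes>\<^sub>M sphere_measure) (\<lambda>p. \<Sum>j\<in>harmonic_indices L. (case p of (\<omega>, x) \<Rightarrow> b (fst j) (snd j) \<omega> * harmonic j x))"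
      by (intro in_L2_sum summand valid_indexI)
    from in_L2_diff[OF in_L2_deformed_field[OF U] this]
    have d: "in_L2 (M \<Otimes>\<^sub>M sphere_measure) (\<lambda>(\<omega>, x). Tc \<omega> (U x) - ?s \<omega> x)"
      by (simp add: case_prod_beta')
    have "L2_norm_sq (M \<Otimes>\<^sub>M sphere_measure)
      (\<lambda>p. (\<Sum>l<L. case p of (\<omega>, x) \<Rightarrow> \<Sum>m\<in>{- int l..int l}. b l m \<omega> * sph_harm l m x)
          - (case p of (\<omega>, x) \<Rightarrow> Tc \<omega> (U x)))
      = L2_norm_sq (M \<Otimes>\<^sub>M sphere_measure) (\<lambda>(\<omega>, x). Tc \<omega> (U x) - ?s \<omega> x)"
      by (simp add: case_prod_beta' sum_harmonic_indices norm_minus_commute)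
    also have "\<dots> = (LINT \<omega>|M. L2_norm_sq sphere_measure (\<lambda>x. Tc \<omega> (U x) - ?s \<omega> x))"
      by (rule field_L2_norm_sq(2)[OF d])
    also have "\<dots> = (LINT \<omega>|M. L2_norm_sq sphere_measure (\<lambda>x. Tc \<omega> (U x)) - (\<Sum>j\<in>harmonic_indices L.
        (cmod (deformed_coeff j \<omega>))\<^sup>2))"
    proof (rule integral_cong_AE)
      have "AE \<omega> in M. \<forall>j\<in>harmonic_indices L. b (fst j) (snd j) \<omega> = deformed_coeff j \<omega>"
        using b(2) by (intro AE_finite_allI) (auto dest: valid_indexI)
      with field_L2_norm_sq(4)[OF in_L2_deformed_field[OF U]]
      show "AE \<omega> in M. L2_norm_sq sphere_measure (\<lambda>x. Tc \<omega> (U x) - ?s \<omega> x)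
        = L2_norm_sq sphere_measure (\<lambda>x. Tc \<omega> (U x)) - (\<Sum>j\<in>harmonic_indices L. (cmod (deformed_coeff j \<omega>))\<^sup>2)"
      proof eventually_elim
        case (elim \<omega>)
        \<comment> \<open>This is the correction sum of \<open>sphere_L2_norm_sq_diff\<close>; it
          measures how far the chosen coefficients are from the true ones.\<close>
        have "(\<Sum>j\<in>harmonic_indices L. (cmod (b (fst j) (snd j) \<omega> - deformed_coeff j \<omega>))\<^sup>2) = 0"
          using elim(2) by (intro sum.neutral) auto
        then show ?case
          using sphere_L2_norm_sq_diff[OF elim(1), where L = L and c = "\<lambda>j. b (fst j) (snd j) \<omega>"]
          unfolding deformed_coeff_def by simp
      qed
    qed (use field_L2_norm_sq(3)[OF d] field_L2_norm_sq(3)[OF in_L2_deformed_field[OF U]] in_L2_integrable_sq[OF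
        in_L2_deformed_coeff]
        in \<open>auto intro!: borel_measurable_diff borel_measurable_sum borel_measurable_integrable\<close>)
    also have "\<dots> = (LINT \<omega>|M. L2_norm_sq sphere_measure (\<lambda>x. Tc \<omega> (U x))) - (\<Sum>j\<in>harmonic_indices L.
        L2_norm_sq M (deformed_coeff j))"
      using field_L2_norm_sq(3)[OF in_L2_deformed_field[OF U]] in_L2_integrable_sq[OF
          in_L2_deformed_coeff] by simp
    also have "(LINT \<omega>|M. L2_norm_sq sphere_measure (\<lambda>x. Tc \<omega> (U x))) =
        L2_norm_sq (M \<Otimes>\<^sub>M sphere_measure) (\<lambda>(\<omega>, x). Tc \<omega> (U x))"
      by (rule field_L2_norm_sq(2)[OF in_L2_deformed_field[OF U], symmetric])
    finally show ?thesis .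
  qed
  ultimately show ?thesis
    unfolding L2_sums_def using in_L2_deformed_field[OF U] deformed_field_residual_tendsto_0 by simp
qed

end

end

text \<open>The limits \<open>b\<close> are unique only up to null sets, hence the quantification
  over all families of limits; the first conjunct ensures that such families exist. The conclusions
  transfer from \<open>deformed_coeff\<close> because they concern expectations or mean-square
  convergence.\<close>

theorem theorem13:
  fixes M :: "'w measure"
    and T :: "'w \<Rightarrow> real ^ 3 \<Rightarrow> real"
    and C :: "nat \<Rightarrow> real"
    and U :: "real ^ 3 \<Rightarrow> real ^ 3"
  defines "a \<equiv> harmonic_coeff T"
  assumes field: "isotropic_spherical_random_field M T"
    and spectrum: "angular_power_spectrum M a C"
    and homeo: "\<exists>V. homeomorphism S2 S2 U V"
  shows
    \<comment> \<open>the series defining the coefficients \<open>b\<close> converge\<close>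
    "(\<forall>l'. \<forall>m'\<in>{- int l'..int l'}. \<exists>\<beta>.
        L2_sums M (\<lambda>l \<omega>. \<Sum>m\<in>{- int l..int l}. Q_coeff U l m l' m' * a l m \<omega>) \<beta>)
   \<and> (\<forall>b :: nat \<Rightarrow> int \<Rightarrow> 'w \<Rightarrow> complex.
        (\<forall>l'. \<forall>m'\<in>{- int l'..int l'}.
           L2_sums M (\<lambda>l \<omega>. \<Sum>m\<in>{- int l..int l}. Q_coeff U l m l' m' * a l m \<omega>) (b l' m'))
        \<longrightarrow>
        L2_sums (M \<Otimes>\<^sub>M sphere_measure)
          (\<lambda>l' (\<omega>, x). \<Sum>m'\<in>{- int l'..int l'}. b l' m' \<omega> * sph_harm l' m' x)
          (\<lambda>(\<omega>, x). of_real (T \<omega> (U x)))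
        \<and> (\<forall>l. \<forall>m\<in>{- int l..int l}. integrable M (b l m) \<and> (LINT \<omega>|M. b l m \<omega>) = 0)
        \<and> (\<forall>l l'. \<forall>m\<in>{- int l..int l}. \<forall>m'\<in>{- int l'..int l'}.
             (\<lambda>k. of_real (C k) *
                  (\<Sum>n\<in>{- int k..int k}. Q_coeff U k n l m * cnj (Q_coeff U k n l' m')))
             sums (LINT \<omega>|M. b l m \<omega> * cnj (b l' m' \<omega>))))"
proof -
  interpret F: isotropic_spherical_random_field M T by (rule field)
  interpret spherical_random_field_spectrum M T C
    by unfold_locales (use spectrum in \<open>simp add: a_def\<close>)
  have U: "continuous_on S2 U" "U ` S2 \<subseteq> S2"
    using homeo by (auto simp: homeomorphism_def)
  let ?\<beta> = "\<lambda>l m. deformed_coeff U (l, m)"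
  let ?t = "\<lambda>l' m' l \<omega>. \<Sum>m\<in>{- int l..int l}. Q_coeff U l m l' m' * a l m \<omega>"
  have \<beta>: "L2_sums M (?t l' m') (?\<beta> l' m')" if "m' \<in> {- int l'..int l'}" for l' m'
    using deformed_coeff_sums[OF U, of "(l', m')"] that by (simp add: a_def)
  have main: "L2_sums (M \<Otimes>\<^sub>M sphere_measure) (\<lambda>l' (\<omega>, x). \<Sum>m'\<in>{- int l'..int l'}. b l' m' \<omega> * sph_harm l' m' x)
          (\<lambda>(\<omega>, x). of_real (T \<omega> (U x)))"
      "\<And>l m. m \<in> {- int l..int l} \<Longrightarrow> integrable M (b l m) \<and> (LINT \<omega>|M. b l m \<omega>) = 0"
      "\<And>l l' m m'. m \<in> {- int l..int l} \<Longrightarrow> m' \<in> {- int l'..int l'} \<Longrightarrow>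
        (\<lambda>k. of_real (C k) * (\<Sum>n\<in>{- int k..int k}. Q_coeff U k n l m * cnj (Q_coeff U k n l' m')))
             sums (LINT \<omega>|M. b l m \<omega> * cnj (b l' m' \<omega>))"
    if b: "\<And>l' m'. m' \<in> {- int l'..int l'} \<Longrightarrow> L2_sums M (?t l' m') (b l' m')" for b
  proof -
    have L2: "in_L2 M (b l m)" if "m \<in> {- int l..int l}" for l m
      using b[OF that] by (simp add: L2_sums_def)
    have ae: "AE \<omega> in M. b l m \<omega> = ?\<beta> l m \<omega>" if "m \<in> {- int l..int l}" for l m
      using deformed_coeff_unique[OF U, of "(l, m)" "b l m"] b[OF that] that by (simp add: a_def)
    have meas: "b l m \<in> borel_measurable M" "?\<beta> l m \<in> borel_measurable M" if "m \<in> {- int l..int l}" for l m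
      using L2[OF that] in_L2_deformed_coeff[OF U, of "(l, m)"] by (auto simp: in_L2_def)
    show "L2_sums (M \<Otimes>\<^sub>M sphere_measure) (\<lambda>l' (\<omega>, x). \<Sum>m'\<in>{- int l'..int l'}. b l' m' \<omega> * sph_harm l' m' x)
          (\<lambda>(\<omega>, x). of_real (T \<omega> (U x)))"
      using L2 ae by (intro deformed_field_expansion[OF U]) auto
    show "integrable M (b l m) \<and> (LINT \<omega>|M. b l m \<omega>) = 0" if m: "m \<in> {- int l..int l}" for l m
    proof
      show "integrable M (b l m)"
        by (rule in_L2_integrable[OF _ L2[OF m]]) unfold_locales
      have "(LINT \<omega>|M. b l m \<omega>) = (LINT \<omega>|M. ?\<beta> l m \<omega>)"
        by (intro integral_cong_AE meas m ae)
      then show "(LINT \<omega>|M. b l m \<omega>) = 0" by (simp add: expectation_deformed_coeff[OF U])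
    qed
    show "(\<lambda>k. of_real (C k) * (\<Sum>n\<in>{- int k..int k}. Q_coeff U k n l m * cnj (Q_coeff U k n l' m')))
             sums (LINT \<omega>|M. b l m \<omega> * cnj (b l' m' \<omega>))"
      if m: "m \<in> {- int l..int l}" "m' \<in> {- int l'..int l'}" for l l' m m'
    proof -
      have "(LINT \<omega>|M. b l m \<omega> * cnj (b l' m' \<omega>)) = (LINT \<omega>|M. ?\<beta> l m \<omega> * cnj (?\<beta> l' m' \<omega>))"
      proof (rule integral_cong_AE)
        show "AE \<omega> in M. b l m \<omega> * cnj (b l' m' \<omega>) = ?\<beta> l m \<omega> * cnj (?\<beta> l' m' \<omega>)"
          using ae[OF m(1)] ae[OF m(2)] by eventually_elim simp
      qed (use meas m in \<open>auto intro!: borel_measurable_times borel_measurable_cnj\<close>)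
      then show ?thesis
        using covariance_deformed_coeff[OF U, of "(l, m)" "(l', m')"] m by simp
    qed
  qed
  show ?thesis
    using \<beta> main by blast
qed

end
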